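(* Let $g\in\mathrm{Out}(\mathbf{F}_2)\cong\mathrm{GL}_2(\mathbf{Z})$ be pseudo-Anosov, i.e. its matrix has two distinct real eigenvalues, and let $\lambda$ be the eigenvalue of this matrix of largest modulus. Then there is a constant $C=C(g)$, depending on $g$ but not on $\kappa$, such that for every $\kappa\in\mathbf{Z}$ and all sufficiently large primes $p$, the permutation of $\mathbb{X}_\kappa(\mathbb{F}_p)$ induced by $g$ has an orbit of length at least $\frac{\log p}{\log|\lambda|}-C$.
   Context: For $\kappa\in\mathbf{Z}$, $\mathbb{X}_\kappa(\mathbb{F}_p)=\{(x,y,z)\in\mathbb{F}_p^3: x^2+y^2+z^2=xyz+2+\kappa\}$. For $w\in\mathbf{F}_2=\langle X,Y\rangle$ let $P_w\in\mathbf{Z}[x,y,z]$ be the unique polynomial with $\mathrm{tr}(w(A,B))=P_w(\mathrm{tr}A,\mathrm{tr}B,\mathrm{tr}AB)$ for all $A,B\in\mathrm{SL}_2(\mathbf{C})$. An automorphism $\theta$ of $\mathbf{F}_2$ with $\theta(X)=w_1,\theta(Y)=w_2$ acts on $\mathbb{X}_\kappa$ by $(x,y,z)\mapsto(P_{w_1},P_{w_2},P_{w_1w_2})(x,y,z)$; this depends only on the outer class of $\theta$, giving an action of $\mathrm{Out}(\mathbf{F}_2)$ by automorphisms defined over $\mathbf{Z}$, hence a permutation of $\mathbb{X}_\kappa(\mathbb{F}_p)$. The identification $\mathrm{Out}(\mathbf{F}_2)\cong\mathrm{GL}_2(\mathbf{Z})$ is via the action on the abelianization $\mathbf{Z}^2$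 with basis induced by $X,Y$. *)

theory Defs
  imports
    "HOL-Analysis.Analysis"
    "HOL-Algebra.Coset"
    "HOL-Algebra.Bij"
    "HOL-Combinatorics.Orbits"
    "HOL-Computational_Algebra.Polynomial"
    "HOL-Number_Theory.Cong"
begin

text \<open>The free group on two generators as the group of reduced words. A letter is a generator
  with a sign; \<open>(s, True)\<close> stands for the inverse of the generator \<open>s\<close>.\<close>

datatype gen = GX | GY

type_synonym letter = "gen \<times> bool"

definition letter_inv :: "letter \<Rightarrow> letter" where
  "letter_inv a = (fst a, \<not> snd a)"

definition reduced :: "letter list \<Rightarrow> bool" where
  "reduced w = successively (\<lambda>a b. b \<noteq> letter_inv a) w"

definition letter_mult :: "letter \<Rightarrow> letter list \<Rightarrow> letter list" where
  "letter_mult a w = (case w of [] \<Rightarrow> [a] | b # v \<Rightarrow> if b = letter_inv a then v else a # w)"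

definition F2 :: "letter list monoid" where
  "F2 = \<lparr>carrier = {w. reduced w}, mult = foldr letter_mult, one = []\<rparr>"

definition genX :: "letter list" where "genX = [(GX, False)]"

definition genY :: "letter list" where "genY = [(GY, False)]"

lemma letter_inv_inv [simp]: "letter_inv (letter_inv a) = a"
  by (simp add: letter_inv_def)

lemma letter_inv_neq [simp]: "letter_inv a \<noteq> a" "a \<noteq> letter_inv a"
  by (auto simp: letter_inv_def prod_eq_iff)

lemma reduced_Nil [simp]: "reduced []"
  by (simp add: reduced_def)

lemma reduced_ConsD: "reduced (a # w) \<Longrightarrow> reduced w"
  by (cases w) (auto simp: reduced_def)

lemma reduced_letter_mult: "reduced w \<Longrightarrow> reduced (letter_mult a w)"
  by (cases w) (auto simp: letter_mult_def reduced_def intro: reduced_ConsD[unfolded reduced_def])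

lemma letter_mult_eq_Cons: "reduced (a # w) \<Longrightarrow> letter_mult a w = a # w"
  by (cases w) (auto simp: letter_mult_def reduced_def)

lemma letter_mult_cancel: "reduced w \<Longrightarrow> letter_mult a (letter_mult (letter_inv a) w) = w"
proof (cases w)
  case (Cons b v)
  assume "reduced w"
  then show ?thesis
    using Cons letter_mult_eq_Cons[of a v] by (auto simp: letter_mult_def)
qed (simp add: letter_mult_def)

lemma reduced_foldr: "reduced w \<Longrightarrow> reduced (foldr letter_mult u w)"
  by (induction u) (auto intro: reduced_letter_mult)

lemma foldr_letter_mult:
  assumes "reduced w"
  shows "foldr letter_mult (letter_mult a t) w = letter_mult a (foldr letter_mult t w)"
proof (cases t)
  case (Cons b v)
  then show ?thesis
    using letter_mult_cancel[OF reduced_foldr[OF assms], of a v]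
    by (cases "b = letter_inv a") (simp_all add: letter_mult_def[of a "_ # v"])
qed (simp add: letter_mult_def[of a "[]"])

lemma foldr_assoc:
  assumes "reduced w"
  shows "foldr letter_mult (foldr letter_mult u v) w = foldr letter_mult u (foldr letter_mult v w)"
  by (induction u) (simp_all add: foldr_letter_mult[OF assms])

lemma reduced_rev_inv: "reduced u \<Longrightarrow> reduced (rev (map letter_inv u))"
  unfolding reduced_def successively_rev successively_map
  by (erule successively_mono) (metis letter_inv_inv)

lemma foldr_rev_inv: "foldr letter_mult (rev (map letter_inv u)) u = []"
proof (induction u)
  case (Cons a u)
  have "letter_mult (letter_inv a) (a # u) = u"
    by (simp add: letter_mult_def)
  with Cons show ?case by simp
qed simp

lemma group_F2: "group F2"
proof (rule groupI)
  fix x assume "x \<in> carrier F2"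
  then show "\<exists>y\<in>carrier F2. y \<otimes>\<^bsub>F2\<^esub> x = \<one>\<^bsub>F2\<^esub>"
    using reduced_rev_inv foldr_rev_inv by (auto simp: F2_def)
qed (auto simp: F2_def foldr_assoc intro: reduced_foldr)


definition Inn :: "('a, 'b) monoid_scheme \<Rightarrow> ('a \<Rightarrow> 'a) set" where
  "Inn G = {(\<lambda>x\<in>carrier G. a \<otimes>\<^bsub>G\<^esub> x \<otimes>\<^bsub>G\<^esub> inv\<^bsub>G\<^esub> a) | a. a \<in> carrier G}"

definition Out :: "('a, 'b) monoid_scheme \<Rightarrow> ('a \<Rightarrow> 'a) set monoid" where
  "Out G = AutoGroup G Mod Inn G"

definition exp_sum :: "gen \<Rightarrow> letter list \<Rightarrow> int" where
  "exp_sum s w = (\<Sum>a\<leftarrow>w. if fst a \<noteq> s then 0 else if snd a then -1 else 1)"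

text \<open>The matrix of the induced automorphism of the abelianization; columns are the images of the
  basis vectors.\<close>

definition aut_matrix :: "(letter list \<Rightarrow> letter list) \<Rightarrow> int^2^2" where
  "aut_matrix \<theta> = vector [vector [exp_sum GX (\<theta> genX), exp_sum GX (\<theta> genY)],
                          vector [exp_sum GY (\<theta> genX), exp_sum GY (\<theta> genY)]]"

text \<open>An outer class is a coset \<open>g\<close> of automorphisms. A quantity that depends only on the outer
  class takes a single value on \<open>g\<close>, which \<^const>\<open>the_elem\<close> extracts.\<close>

definition out_matrix :: "(letter list \<Rightarrow> letter list) set \<Rightarrow> int^2^2" where
  "out_matrix g = the_elem (aut_matrix ` g)"

definition eigenvalue :: "'a::field^'n^'n \<Rightarrow> 'a \<Rightarrow> bool" where
  "eigenvalue A c \<longleftrightarrow> (\<exists>v. v \<noteq> 0 \<and> A *v v = c *s v)"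

definition out_eigenvalue :: "(letter list \<Rightarrow> letter list) set \<Rightarrow> real \<Rightarrow> bool" where
  "out_eigenvalue g c \<longleftrightarrow> eigenvalue (map_matrix real_of_int (out_matrix g)) c"

definition pseudo_Anosov :: "(letter list \<Rightarrow> letter list) set \<Rightarrow> bool" where
  "pseudo_Anosov g \<longleftrightarrow> (\<exists>a b. a \<noteq> b \<and> out_eigenvalue g a \<and> out_eigenvalue g b)"

definition largest_eigenvalue :: "(letter list \<Rightarrow> letter list) set \<Rightarrow> real \<Rightarrow> bool" where
  "largest_eigenvalue g c \<longleftrightarrow>
     out_eigenvalue g c \<and> (\<forall>d. out_eigenvalue g d \<and> d \<noteq> c \<longrightarrow> \<bar>d\<bar> < \<bar>c\<bar>)"


definition word_eval :: "complex^2^2 \<Rightarrow> complex^2^2 \<Rightarrow> letter list \<Rightarrow> complex^2^2" where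
  "word_eval A B w =
     foldr (\<lambda>a M. (let L = (case fst a of GX \<Rightarrow> A | GY \<Rightarrow> B)
                   in if snd a then matrix_inv L else L) ** M) w (mat 1)"

text \<open>The ring $\mathbf{Z}[x,y,z]$ is represented as $\mathbf{Z}[x][y][z]$.\<close>

definition eval3 :: "int poly poly poly \<Rightarrow> 'a::comm_ring_1 \<Rightarrow> 'a \<Rightarrow> 'a \<Rightarrow> 'a" where
  "eval3 P x y z =
     poly (map_poly (\<lambda>Q. poly (map_poly (\<lambda>R. poly (map_poly of_int R) x) Q) y) P) z"

definition trace_poly :: "letter list \<Rightarrow> int poly poly poly" where
  "trace_poly w = (THE P. \<forall>A B :: complex^2^2. det A = 1 \<and> det B = 1 \<longrightarrow>
     trace (word_eval A B w) = eval3 P (trace A) (trace B) (trace (A ** B)))"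

text \<open>Elements of $\mathbb{F}_p$ are represented by the integers in \<open>{0..<p}\<close>.\<close>

definition XF :: "int \<Rightarrow> nat \<Rightarrow> (int \<times> int \<times> int) set" where
  "XF \<kappa> p = {(x, y, z). x \<in> {0..<int p} \<and> y \<in> {0..<int p} \<and> z \<in> {0..<int p} \<and>
     [x\<^sup>2 + y\<^sup>2 + z\<^sup>2 = x * y * z + 2 + \<kappa>] (mod int p)}"

definition aut_act ::
  "nat \<Rightarrow> (letter list \<Rightarrow> letter list) \<Rightarrow> int \<times> int \<times> int \<Rightarrow> int \<times> int \<times> int" where
  "aut_act p \<theta> = (\<lambda>(x, y, z).
     (eval3 (trace_poly (\<theta> genX)) x y z mod int p,
      eval3 (trace_poly (\<theta> genY)) x y z mod int p,
      eval3 (trace_poly (\<theta> genX \<otimes>\<^bsub>F2\<^esub> \<theta> genY)) x y z mod int p))"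

text \<open>The same formula serves for every \<open>\<kappa>\<close>; on \<open>XF \<kappa> p\<close> it is the permutation induced by the outer
  class \<open>g\<close>.\<close>

definition out_act ::
  "nat \<Rightarrow> (letter list \<Rightarrow> letter list) set \<Rightarrow> int \<times> int \<times> int \<Rightarrow> int \<times> int \<times> int" where
  "out_act p g v = the_elem ((\<lambda>\<theta>. aut_act p \<theta> v) ` g)"

end

theory Submission
  imports Defs "HOL-Library.Sublist"
begin

text \<open>The surface contains a rational curve with \<open>p - 1\<close> parameter values on which few points are fixed by
  $g^n$. Take \<open>A = diag(a, 1 / a)\<close> and \<open>B = ((t, q), (1, (1 + q) / t))\<close>, where \<open>a\<close> is fixed and
  \<open>(a - 1 / a)\<^sup>2 q = 2 - \<kappa>\<close>: the traces of \<open>A\<close>, \<open>B\<close>, \<open>AB\<close> satisfy the equation of the surface for every \<open>t\<close>.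

  Nielsen reduction shows that every primitive element of the free group is conjugate, up to inversion, to
  a word without the letter $Y^{-1}$. If such a word has \<open>N > 0\<close> letters \<open>Y\<close>, then its trace along the curve
  is a Laurent polynomial in \<open>t\<close> with top term a unit times $t^N$ and lowest exponent at least \<open>- N\<close>,
  so it takes the value \<open>a + 1 / a\<close> at most \<open>2 N\<close> times modulo \<open>p\<close>. For the image of \<open>X\<close> under the $n$-th
  iterate, \<open>N\<close> is the modulus of an off-diagonal entry of the $n$-th power of the matrix, which is nonzero and
  $O(|\lambda|^n)$. Hence points of period at most \<open>K\<close> account for only $O(|\lambda|^K)$ parameters, and some point
  on the curve has a longer orbit as soon as this is below \<open>p - 1\<close>.\<close>

section \<open>Bases of the free group of rank two\<close>

text \<open>The curve comes from Fricke's identity: if x, y, z are the traces of A, B, AB in SL2,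
  then x^2 + y^2 + z^2 - xyz - 2 is the trace of the commutator of A and B, so the surface is the
  locus where that trace is \<kappa>. For diagonal A the commutator trace is 2 - (a - 1/a)^2 times
  the product of the off-diagonal entries of B, and this product does not involve t. The obstacle is
  degeneration: along the curve the trace of a general word may be constant, or lose its leading
  coefficient modulo p, and then counting roots gives nothing. Without the letter Y^{-1} the leading
  coefficient is a product of powers of a and 1/a, a unit for every p, and the degree is an exponent
  sum, visible in the abelianization. This is what makes the bound uniform in p and \<kappa>. Points
  over the prime field come from integer matrices with determinant 1 only modulo p. The trace
  identities are therefore proved as divisibility by m in any commutative ring; m = 0 gives the
  exact identities over the complex numbers.\<close>

inductive farey :: "'a::group_add \<Rightarrow> 'a \<Rightarrow> 'a \<Rightarrow> 'a \<Rightarrow> bool" for a b where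
  base: "farey a b a b"
| right: "farey a b u v \<Longrightarrow> farey a b u (u + v)"
| left: "farey a b u v \<Longrightarrow> farey a b (u + v) v"

text \<open>Additive notation for a noncommutative group: \<open>c + p - c\<close> is the conjugate
  of \<open>p\<close> by \<open>c\<close>.\<close>

definition conj_inverse :: "'a::group_add \<Rightarrow> 'a \<Rightarrow> 'a \<Rightarrow> bool" where
  "conj_inverse c u p \<longleftrightarrow> u = c + p - c \<or> u = c + (- p) - c"

text \<open>The moves of \<open>farey\<close> reach only positive words in the two starting
  elements; starting from \<open>- b\<close> as well covers the other sign of slope.\<close>

definition farey_basis :: "'a::group_add \<Rightarrow> 'a \<Rightarrow> 'a \<Rightarrow> 'a \<Rightarrow> bool" where
  "farey_basis a b u v \<longleftrightarrow> (\<exists>p q c. (farey a b p q \<or> farey a (- b) p q) \<and>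
     (conj_inverse c u p \<and> conj_inverse c v q \<or> conj_inverse c u q \<and> conj_inverse c v p))"

lemmas group_add_normalize = add.assoc diff_conv_add_uminus minus_add

lemma conj_inverse_uminus: "conj_inverse c u p \<Longrightarrow> conj_inverse c (- u) p"
  by (auto simp: conj_inverse_def group_add_normalize simp del: add_uminus_conv_diff)

lemma conj_inverse_conj: "conj_inverse c u p \<Longrightarrow> conj_inverse (d + c) (d + u - d) p"
  by (auto simp: conj_inverse_def group_add_normalize simp del: add_uminus_conv_diff)

lemma farey_basisI:
  assumes "farey a b p q \<or> farey a (- b) p q"
    and "conj_inverse c u p \<and> conj_inverse c v q \<or> conj_inverse c u q \<and> conj_inverse c v p"
  shows "farey_basis a b u v"
  using assms unfolding farey_basis_def by blast

lemma farey_basis_swap: "farey_basis a b u v \<Longrightarrow> farey_basis a b v u"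
  unfolding farey_basis_def by blast

lemma farey_basis_uminus: "farey_basis a b u v \<Longrightarrow> farey_basis a b (- u) v"
  unfolding farey_basis_def using conj_inverse_uminus by blast

lemma farey_basis_uminus_iff:
  "farey_basis a b (- u) v \<longleftrightarrow> farey_basis a b u v"
  "farey_basis a b u (- v) \<longleftrightarrow> farey_basis a b u v"
  by (metis farey_basis_uminus farey_basis_swap minus_minus)+

lemma farey_basis_conj: "farey_basis a b u v \<Longrightarrow> farey_basis a b (d + u - d) (d + v - d)"
  unfolding farey_basis_def using conj_inverse_conj by blast

lemma conj_conj_uminus: "- d + (d + u - d) - (- d) = (u::'a::group_add)"
  by (simp add: group_add_normalize del: add_uminus_conv_diff)

lemma farey_basis_conj_iff: "farey_basis a b (d + u - d) (d + v - d) \<longleftrightarrow> farey_basis a b u v"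
  using farey_basis_conj[of a b u v d] farey_basis_conj[of a b "d + u - d" "d + v - d" "- d"]
  by (auto simp: conj_conj_uminus simp del: diff_minus_eq_add)

lemma farey_imp_farey_basis: "farey a b p q \<or> farey a (- b) p q \<Longrightarrow> farey_basis a b p q"
  by (rule farey_basisI[where c = 0]) (auto simp: conj_inverse_def)

text \<open>Subtraction undoes the last Farey move, possibly up to conjugation. At the root there is
  nothing to undo, and subtraction passes to the tree with the other sign of
  \<open>b\<close>.\<close>

lemma farey_basis_diff:
  assumes "farey a b p q \<or> farey a (- b) p q"
  shows "farey_basis a b (p - q) q \<and> farey_basis a b (p - q) p"
proof -
  define b' where "b' = (if farey a b p q then b else - b)"
  have b': "farey a b' p q" "b' = b \<or> b' = - b"
    using assms by (auto simp: b'_def)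
  have lift: "farey_basis a b u v" if "farey a b' u v" for u v
    using that b'(2) by (auto intro: farey_imp_farey_basis)
  show ?thesis
    using b'(1)
  proof cases
    case base
    have "farey a (- b') a (- b')" by (rule farey.base)
    then have "farey a (- b') (a + - b') (- b')" "farey a (- b') a (a + - b')"
      by (rule farey.intros)+
    then have "farey_basis a b (a - b') (- b')" "farey_basis a b a (a - b')"
      using b'(2) by (auto intro!: farey_imp_farey_basis)
    with base show ?thesis
      by (auto simp: farey_basis_uminus_iff intro: farey_basis_swap)
  next
    \<comment> \<open>Here \<open>q = p + v\<close>, so \<open>p - q\<close> is \<open>- v\<close>
      conjugated by \<open>p\<close>, and the pair is the conjugate by \<open>p\<close> of
      \<open>(- v, v + p)\<close>, itself a left move on \<open>(p, v)\<close> after conjugation by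
      \<open>v\<close>, swap and inversion.\<close>
    case (right v)
    have *: "p + - v - p = p - q" "p + (v + p) - p = q" "p + p - p = p"
      by (simp_all add: right group_add_normalize del: add_uminus_conv_diff)
    have "farey_basis a b (p + v) v"
      by (rule lift, rule farey.left, fact)
    then have "farey_basis a b (v + (p + v) - v) (v + v - v)"
      by (rule farey_basis_conj)
    then have "farey_basis a b (v + p) v"
      by (simp add: group_add_normalize del: add_uminus_conv_diff)
    then have "farey_basis a b (- v) (v + p)"
      by (simp add: farey_basis_uminus_iff farey_basis_swap)
    moreover have "farey_basis a b (- v) p"
      using lift[OF right(2)] by (simp add: farey_basis_uminus_iff farey_basis_swap)
    ultimately show ?thesis
      using farey_basis_conj[of a b "- v" "v + p" p, unfolded *]
        farey_basis_conj[of a b "- v" p p, unfolded *] by blast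
  next
    case (left u)
    have "farey_basis a b u q" "farey_basis a b u (u + q)"
      using left(2) by (auto intro!: lift farey.intros)
    with left show ?thesis by simp
  qed
qed

text \<open>Signs and order leave eight sums to treat. Conjugation exchanges \<open>x + y\<close>
  with \<open>y + x\<close>, and inversion then reduces each of them to \<open>p + q\<close> or
  \<open>p - q\<close>.\<close>

lemma farey_basis_add_left:
  assumes "farey_basis a b u v"
  shows "farey_basis a b (u + v) v"
proof -
  obtain p q c where f: "farey a b p q \<or> farey a (- b) p q" and
    c: "conj_inverse c u p \<and> conj_inverse c v q \<or> conj_inverse c u q \<and> conj_inverse c v p"
    using assms by (auto simp: farey_basis_def)
  have sums: "farey_basis a b (p + q) q" "farey_basis a b (p + q) p"
    using f by (auto intro: farey_imp_farey_basis farey_basis_swap farey.intros)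
  note diffs = farey_basis_diff[OF f, THEN conjunct1] farey_basis_diff[OF f, THEN conjunct2]
  have flip: "farey_basis a b (x + y) y \<longleftrightarrow> farey_basis a b (y + x) y" for x y :: 'a
    using farey_basis_conj_iff[of a b y "x + y" y] by (simp add: group_add_normalize del: add_uminus_conv_diff)
  have flip': "farey_basis a b (x - y) y \<longleftrightarrow> farey_basis a b (- y + x) y" for x y :: 'a
    using farey_basis_conj_iff[of a b "- y" "x - y" y] by (simp add: group_add_normalize del: add_uminus_conv_diff)
  have "farey_basis a b (- p + q) q" "farey_basis a b (- p - q) q"
    "farey_basis a b (q + p) p" "farey_basis a b (- q + p) p"
    "farey_basis a b (- q - p) p" "farey_basis a b (q - p) p"
  proof -
    show "farey_basis a b (- p + q) q"
      using diffs(1) flip'[of p q] farey_basis_uminus_iff(1)[of a b "- p + q" q]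
      by (simp add: minus_add)
    show "farey_basis a b (- p - q) q"
      using sums(1) flip[of p q] farey_basis_uminus_iff(1)[of a b "- p - q" q] by simp
    show "farey_basis a b (q + p) p"
      using sums(2) flip[of q p] by simp
    show "farey_basis a b (- q + p) p"
      using diffs(2) flip[of "- q" p] by simp
    show "farey_basis a b (- q - p) p"
      using sums(2) farey_basis_uminus_iff(1)[of a b "- q - p" p] by simp
    show "farey_basis a b (q - p) p"
      using diffs(2) farey_basis_uminus_iff(1)[of a b "q - p" p] by simp
  qed
  with sums diffs have *: "farey_basis a b (x + y) y"
    if "x \<in> {p, - p} \<and> y \<in> {q, - q} \<or> x \<in> {q, - q} \<and> y \<in> {p, - p}" for x y
    using that by (auto simp: farey_basis_uminus_iff)
  obtain x y where xy: "u = c + x - c" "v = c + y - c"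
    "x \<in> {p, - p} \<and> y \<in> {q, - q} \<or> x \<in> {q, - q} \<and> y \<in> {p, - p}"
    using c unfolding conj_inverse_def by blast
  then have "u + v = c + (x + y) - c"
    by (simp add: group_add_normalize del: add_uminus_conv_diff)
  with farey_basis_conj[OF *[OF xy(3)], of c] xy(2) show ?thesis by simp
qed

lemma farey_basis_add_left_iff: "farey_basis a b (u + v) v \<longleftrightarrow> farey_basis a b u v"
  using farey_basis_add_left[of a b u v] farey_basis_add_left[of a b "u + v" "- v"]
  by (auto simp: farey_basis_uminus_iff)

lemma farey_basis_add_right_iff: "farey_basis a b u (u + v) \<longleftrightarrow> farey_basis a b u v"
proof -
  have "farey_basis a b u (u + v) \<longleftrightarrow> farey_basis a b (v + u) u"
    using farey_basis_conj_iff[of a b u "v + u" u] farey_basis_swap[of a b u "u + v"]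
      farey_basis_swap[of a b "u + v" u] by (auto simp: group_add_normalize simp del: add_uminus_conv_diff)
  then show ?thesis
    using farey_basis_swap farey_basis_add_left_iff by blast
qed

section \<open>The free group as a type of class \<open>group_add\<close>; length and
  cancellation\<close>

typedef f2 = "{w. reduced w}"
  by (rule exI[of _ "[]"]) simp

setup_lifting type_definition_f2

lemma foldr_letter_mult_append: "reduced (u @ v) \<Longrightarrow> foldr letter_mult u v = u @ v"
proof (induction u)
  case (Cons a u)
  then show ?case
    using reduced_ConsD[of a "u @ v"] by (simp add: letter_mult_eq_Cons)
qed simp

instantiation f2 :: group_add
begin

lift_definition zero_f2 :: f2 is "[]" by simp

lift_definition plus_f2 :: "f2 \<Rightarrow> f2 \<Rightarrow> f2" is "foldr letter_mult" by (rule reduced_foldr)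

lift_definition uminus_f2 :: "f2 \<Rightarrow> f2" is "\<lambda>w. rev (map letter_inv w)"
  by (rule reduced_rev_inv)

definition minus_f2 :: "f2 \<Rightarrow> f2 \<Rightarrow> f2" where "minus_f2 u v = u + - v"

instance
proof
  fix a b c :: f2
  show "a + b + c = a + (b + c)"
    by transfer (rule foldr_assoc)
  show "0 + a = a" "- a + a = 0"
    by (transfer; simp add: foldr_rev_inv)+
  show "a + 0 = a"
    by transfer (simp add: foldr_letter_mult_append)
  show "a + - b = a - b"
    by (simp add: minus_f2_def)
qed

end

lift_definition f2_letter :: "letter \<Rightarrow> f2" is "\<lambda>a. [a]" by (simp add: reduced_def)

lemma f2_letter_inv: "f2_letter (letter_inv a) = - f2_letter a"
  by transfer simp

lemma f2_letter_GX_GY: "f2_letter (GX, True) = - f2_letter (GX, False)"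
  "f2_letter (GY, True) = - f2_letter (GY, False)"
  by (simp_all flip: f2_letter_inv add: letter_inv_def)

lemma sum_list_f2_letter: "sum_list (map f2_letter (Rep_f2 g)) = g"
proof -
  have "Rep_f2 (sum_list (map f2_letter w)) = w" if "reduced w" for w
    using that
  proof (induction w)
    case (Cons a w)
    then show ?case
      using reduced_ConsD[of a w] by (simp add: plus_f2.rep_eq f2_letter.rep_eq letter_mult_eq_Cons)
  qed (simp add: zero_f2.rep_eq)
  then show ?thesis
    using Rep_f2[of g] by (metis Rep_f2_inverse mem_Collect_eq)
qed

definition len :: "f2 \<Rightarrow> nat" where "len g = length (Rep_f2 g)"

text \<open>The Gromov product based at the identity of the Cayley tree: the number of letters that
  each factor loses in \<open>- g + h\<close>.\<close>

definition common :: "f2 \<Rightarrow> f2 \<Rightarrow> nat" where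
  "common g h = length (longest_common_prefix (Rep_f2 g) (Rep_f2 h))"

lemma foldr_letter_mult_inv_append: "foldr letter_mult (rev (map letter_inv z)) (z @ h) = h"
  by (induction z) (auto simp: letter_mult_def)

lemma reduced_appendD: "reduced (u @ v) \<Longrightarrow> reduced u \<and> reduced v"
  by (auto simp: reduced_def successively_append_iff)

lemma len_uminus [simp]: "len (- g) = len g"
  by (simp add: len_def uminus_f2.rep_eq)

lemma len_0_iff [simp]: "len g = 0 \<longleftrightarrow> g = 0"
  by (simp add: len_def) (metis Rep_f2_inject zero_f2.rep_eq)

lemma len_0 [simp]: "len 0 = 0"
  by simp

lemma len_uminus_add: "len (- g + h) + 2 * common g h = len g + len h"
proof -
  define z where "z = longest_common_prefix (Rep_f2 g) (Rep_f2 h)"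
  obtain g1 where g1: "Rep_f2 g = z @ g1"
    using longest_common_prefix_prefix1[of "Rep_f2 g" "Rep_f2 h"] by (auto simp: z_def prefix_def)
  obtain h1 where h1: "Rep_f2 h = z @ h1"
    using longest_common_prefix_prefix2[of "Rep_f2 g" "Rep_f2 h"] by (auto simp: z_def prefix_def)
  have ne: "hd g1 \<noteq> hd h1" if "g1 \<noteq> []" "h1 \<noteq> []"
  proof
    assume "hd g1 = hd h1"
    then have "prefix (z @ [hd g1]) (Rep_f2 g)" "prefix (z @ [hd g1]) (Rep_f2 h)"
      using that g1 h1 by (cases g1; cases h1; simp)+
    then have "prefix (z @ [hd g1]) z"
      unfolding z_def by (rule longest_common_prefix_max_prefix)
    then show False using prefix_length_le by fastforce
  qed
  have red: "reduced (rev (map letter_inv g1))" "reduced h1"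
    using Rep_f2[of g] Rep_f2[of h] unfolding g1 h1
    by (auto dest!: reduced_appendD intro: reduced_rev_inv)
  have "reduced (rev (map letter_inv g1) @ h1)"
    using red ne by (auto simp: reduced_def successively_append_iff last_rev hd_map)
  then have "Rep_f2 (- g + h) = rev (map letter_inv g1) @ h1"
    by (simp add: plus_f2.rep_eq uminus_f2.rep_eq g1 h1 foldr_letter_mult_inv_append
        foldr_letter_mult_append)
  then have "len (- g + h) = length g1 + length h1"
    by (simp add: len_def)
  then show ?thesis
    unfolding len_def common_def z_def[symmetric] by (simp add: g1 h1)
qed

lemma longest_common_prefix_commute: "longest_common_prefix xs ys = longest_common_prefix ys xs"
  by (induction xs ys rule: longest_common_prefix.induct) auto

lemma common_commute: "common g h = common h g"
  by (simp add: common_def longest_common_prefix_commute)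

lemma length_longest_common_prefix_trans:
  "min (length (longest_common_prefix xs ys)) (length (longest_common_prefix ys zs))
    \<le> length (longest_common_prefix xs zs)"
proof (induction xs ys arbitrary: zs rule: longest_common_prefix.induct)
  case (1 x xs y ys)
  then show ?case by (cases zs) auto
qed auto

text \<open>The ultrametric inequality of a tree: \<open>g\<close> and \<open>k\<close> both begin
  with the shorter of the prefixes they share with \<open>h\<close>.\<close>

lemma common_min: "min (common g h) (common h k) \<le> common g k"
  unfolding common_def by (rule length_longest_common_prefix_trans)

lemma common_less: "common g h < common h k \<Longrightarrow> common g k = common g h"
  using common_min[of g h k] common_min[of g k h] common_commute[of k h] by (simp add: min_def split: if_splits)

lemma common_le: "common g h \<le> len g" "common g h \<le> len h"
  unfolding common_def len_def
  by (simp_all add: longest_common_prefix_prefix1 longest_common_prefix_prefix2 prefix_length_le)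

text \<open>If half of \<open>g\<close> agreed with \<open>- g\<close>, the reduced word would read
  as its own inverse up to the middle: two adjacent letters would be mutually inverse, or a middle
  letter would be its own inverse. Thus doubling \<open>g\<close> cancels less than half of
  it.\<close>

lemma common_uminus_self:
  assumes "g \<noteq> 0"
  shows "2 * common g (- g) < len g"
proof (rule ccontr)
  define xs where "xs = Rep_f2 g"
  define k where "k = common g (- g)"
  assume "\<not> ?thesis"
  then have k: "length xs \<le> 2 * k" by (simp add: xs_def k_def len_def)
  have L: "length xs > 0" using assms len_0_iff[of g] unfolding len_def xs_def by blast
  define z where "z = longest_common_prefix xs (rev (map letter_inv xs))"
  have z: "prefix z xs" "prefix z (rev (map letter_inv xs))" "length z = k"
    by (simp_all add: z_def longest_common_prefix_prefix1 longest_common_prefix_prefix2 k_def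
        common_def xs_def uminus_f2.rep_eq)
  have kL: "k \<le> length xs" using z(1,3) prefix_length_le by blast
  have eq: "xs ! i = letter_inv (xs ! (length xs - 1 - i))" if "i < k" for i
  proof -
    have "xs ! i = z ! i" using z(1,3) that by (auto simp: prefix_def nth_append)
    also have "\<dots> = rev (map letter_inv xs) ! i" using z(2,3) that by (auto simp: prefix_def nth_append)
    also have "\<dots> = letter_inv (xs ! (length xs - 1 - i))"
      using that kL by (simp add: rev_nth)
    finally show ?thesis .
  qed
  have middle: "(n - 1) div 2 < m" if "0 < n" "n \<le> 2 * m" for n m :: nat
    using that by presburger
  have middle_even: "n - 1 - (n - 1) div 2 = Suc ((n - 1) div 2) \<and> Suc ((n - 1) div 2) < n"
    if "even n" "0 < n" for n :: nat
  proof -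
    obtain m where "n = 2 * m" using \<open>even n\<close> by (elim evenE)
    then show ?thesis using \<open>0 < n\<close> by (cases m) auto
  qed
  have middle_odd: "n - 1 - (n - 1) div 2 = (n - 1) div 2" if "odd n" for n :: nat
    using that by (auto elim!: oddE)
  \<comment> \<open>The middle position for odd length, the last position of the first half for even
    length.\<close>
  define i where "i = (length xs - 1) div 2"
  have i: "i < k" using middle[of "length xs" k] k L by (simp add: i_def)
  show False
  proof (cases "even (length xs)")
    case True
    then have i': "length xs - 1 - i = Suc i" "Suc i < length xs"
      using middle_even[of "length xs"] L unfolding i_def by blast+
    have "xs ! Suc i \<noteq> letter_inv (xs ! i)"
      using Rep_f2[of g] i'(2) by (simp add: xs_def reduced_def successively_conv_nth)
    with eq[OF i] i' show False by simp
  next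
    case False
    then have "length xs - 1 - i = i"
      using middle_odd[of "length xs"] unfolding i_def by blast
    with eq[OF i] show False by simp
  qed
qed

lemma prefix_exists:
  assumes "k \<le> len u"
  obtains p where "len p = k" "common p u = k"
proof
  have red: "reduced (take k (Rep_f2 u))"
    using Rep_f2[of u] reduced_appendD[of "take k (Rep_f2 u)" "drop k (Rep_f2 u)"] by simp
  have Rep: "Rep_f2 (Abs_f2 (take k (Rep_f2 u))) = take k (Rep_f2 u)"
    using red by (simp add: Abs_f2_inverse)
  have lcp: "longest_common_prefix (take k xs) xs = take k xs" for xs :: "letter list"
  proof (induction xs arbitrary: k)
    case (Cons x xs)
    then show ?case by (cases k) auto
  qed simp
  show "len (Abs_f2 (take k (Rep_f2 u))) = k" "common (Abs_f2 (take k (Rep_f2 u))) u = k"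
    using assms by (simp_all add: len_def common_def Rep lcp)
qed

lemma len_add: "len (g + h) + 2 * common (- g) h = len g + len h"
  using len_uminus_add[of "- g" h] by simp

text \<open>Exactly half of \<open>u\<close> is absorbed by \<open>v\<close> on either side. Write
  \<open>u = p - q\<close> with halves of equal length; then \<open>v = q + v' - p\<close>.
  Conjugation by \<open>p\<close> turns \<open>u + v\<close> into \<open>v'\<close>, which is
  shorter than \<open>v\<close> by \<open>len u\<close>, and turns \<open>u\<close> into
  \<open>- q + p\<close>, which is no longer than \<open>u\<close>.\<close>

lemma conj_shortens:
  assumes "2 * common (- v) u = len u" "2 * common (- u) v = len u" "len u \<le> len v"
  obtains p where "len (- p + u + p) \<le> len u" "len (- p + (u + v) + p) + len u \<le> len v"
proof -
  define k where "k = common (- v) u"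
  have uk: "len u = 2 * k" using assms(1) by (simp add: k_def)
  obtain p where p: "len p = k" "common p u = k"
    using prefix_exists[of k u] uk by auto
  define q where "q = - u + p"
  have q: "len q = k"
    using len_uminus_add[of u p] p uk common_commute[of u p] by (simp add: q_def)
  have uq: "common (- u) q = k"
    using len_uminus_add[of "- u" q] p uk q by (simp add: q_def)
  have qv: "common q v = k"
    using common_min[of q "- u" v] common_commute[of q "- u"] uq assms(2) uk common_le[of q v] q
    by simp
  have pv: "common (- v) p = k"
    using common_min[of "- v" u p] common_commute[of u p] p k_def common_le[of "- v" p] by simp
  have l1: "len (- v + q) + k = len v"
    using len_uminus_add[of v q] common_commute[of v q] qv q by simp
  have "- (- v + q) + - v = - q"
    by (simp add: minus_add)
  then have "len (- v + q) + len v = k + 2 * common (- v + q) (- v)"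
    using len_uminus_add[of "- v + q" "- v"] q by simp
  then have "common (- v + q) (- v) = len v - k" using l1 by linarith
  then have "common (- v + q) p \<ge> k"
    using common_min[of "- v + q" "- v" p] pv assms(3) uk by simp
  then have l2: "len (- (- v + q) + p) + len u \<le> len v"
    using len_uminus_add[of "- v + q" p] l1 p uk by simp
  have "- (- v + q) + p = - p + (u + v) + p"
    by (simp add: q_def minus_add add.assoc)
  with l2 have 1: "len (- p + (u + v) + p) + len u \<le> len v" by simp
  have "- p + u + p = - q + p" by (simp add: q_def minus_add add.assoc)
  then have "len (- p + u + p) \<le> len u"
    using len_uminus_add[of q p] p q uk by simp
  with 1 show thesis using that by blast
qed

text \<open>The universal property of the free group, one letter at a time: values that respect
  inverses are insensitive to free cancellation. It is applied with group elements and with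
  exponents as values.\<close>

lemma sum_list_letter_mult:
  fixes e :: "letter \<Rightarrow> 'a::group_add"
  assumes "\<And>a. e (letter_inv a) = - e a"
  shows "sum_list (map e (letter_mult a w)) = e a + sum_list (map e w)"
  by (cases w) (auto simp: letter_mult_def assms)

lemma sum_list_foldr_letter_mult:
  fixes e :: "letter \<Rightarrow> 'a::group_add"
  assumes "\<And>a. e (letter_inv a) = - e a"
  shows "sum_list (map e (foldr letter_mult u v)) = sum_list (map e u) + sum_list (map e v)"
  by (induction u) (simp_all add: sum_list_letter_mult[where e = e, OF assms] add.assoc)

lemma sum_list_rev_inv:
  fixes e :: "letter \<Rightarrow> 'a::group_add"
  assumes "\<And>a. e (letter_inv a) = - e a"
  shows "sum_list (map e (rev (map letter_inv u))) = - sum_list (map e u)"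
  by (induction u) (simp_all add: assms minus_add)

section \<open>Generating pairs and Nielsen reduction\<close>

definition subgroup_closed :: "'a::group_add set \<Rightarrow> bool" where
  "subgroup_closed S \<longleftrightarrow> (\<forall>a\<in>S. - a \<in> S) \<and> (\<forall>a\<in>S. \<forall>b\<in>S. a + b \<in> S)"

definition generates :: "'a::group_add \<Rightarrow> 'a \<Rightarrow> bool" where
  "generates u v \<longleftrightarrow> (\<forall>S. subgroup_closed S \<longrightarrow> u \<in> S \<longrightarrow> v \<in> S \<longrightarrow> S = UNIV)"

lemma generatesI:
  assumes "generates u v"
    and "\<And>S. subgroup_closed S \<Longrightarrow> u' \<in> S \<Longrightarrow> v' \<in> S \<Longrightarrow> u \<in> S \<and> v \<in> S"
  shows "generates u' v'"
  using assms unfolding generates_def by blast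

lemma subgroup_closed_add: "subgroup_closed S \<Longrightarrow> a \<in> S \<Longrightarrow> b \<in> S \<Longrightarrow> a + b \<in> S"
  and subgroup_closed_uminus: "subgroup_closed S \<Longrightarrow> a \<in> S \<Longrightarrow> - a \<in> S"
  by (auto simp: subgroup_closed_def)

lemma generates_swap: "generates u v \<Longrightarrow> generates v u"
  by (auto simp: generates_def)

lemma generates_uminus: "generates u v \<Longrightarrow> generates (- u) v"
proof (erule generatesI)
  fix S assume "subgroup_closed S" "- u \<in> S" "v \<in> S"
  then show "u \<in> S \<and> v \<in> S"
    using subgroup_closed_uminus[of S "- u"] by simp
qed

lemma generates_commute: "generates u v \<longleftrightarrow> generates v u"
  by (rule iffI; erule generates_swap)

lemma generates_uminus_iff:
  "generates (- u) v \<longleftrightarrow> generates u v"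
  "generates u (- v) \<longleftrightarrow> generates u v"
proof -
  have left: "generates (- u) v \<longleftrightarrow> generates u v" for u v :: 'a
    using generates_uminus[of "- u" v] by (auto intro: generates_uminus)
  show "generates (- u) v \<longleftrightarrow> generates u v" by (rule left)
  show "generates u (- v) \<longleftrightarrow> generates u v"
    by (simp only: generates_commute[of u] left)
qed

lemma generates_add_left: "generates u v \<Longrightarrow> generates (u + v) v"
proof (erule generatesI)
  fix S assume "subgroup_closed S" "u + v \<in> S" "v \<in> S"
  then show "u \<in> S \<and> v \<in> S"
    using subgroup_closed_add[of S "u + v" "- v"] subgroup_closed_uminus[of S v] by simp
qed

lemma generates_add_right: "generates u v \<Longrightarrow> generates u (u + v)"
proof (erule generatesI)
  fix S assume "subgroup_closed S" "u \<in> S" "u + v \<in> S"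
  then show "u \<in> S \<and> v \<in> S"
    using subgroup_closed_add[of S "- u" "u + v"] subgroup_closed_uminus[of S u] by simp
qed

lemma generates_conj:
  fixes c :: "'a::group_add"
  assumes "generates u v"
  shows "generates (c + u - c) (c + v - c)"
  unfolding generates_def
proof (intro allI impI)
  fix S :: "'a set"
  assume S: "subgroup_closed S" "c + u - c \<in> S" "c + v - c \<in> S"
  have "subgroup_closed {x. c + x - c \<in> S}"
    unfolding subgroup_closed_def
  proof (intro conjI ballI; simp)
    fix a assume "c + a - c \<in> S"
    then have "- (c + a - c) \<in> S" by (rule subgroup_closed_uminus[OF S(1)])
    then show "c - a - c \<in> S" 
      by (simp add: group_add_normalize del: add_uminus_conv_diff)
  next
    fix a b assume "c + a - c \<in> S" "c + b - c \<in> S"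
    then have "(c + a - c) + (c + b - c) \<in> S" by (rule subgroup_closed_add[OF S(1)])
    then show "c + (a + b) - c \<in> S"
      by (simp add: group_add_normalize del: add_uminus_conv_diff)
  qed
  then have *: "{x. c + x - c \<in> S} = UNIV"
    using assms S unfolding generates_def by blast
  have "y \<in> S" for y
  proof -
    have "- c + y + c \<in> {x. c + x - c \<in> S}" using * by blast
    then show "y \<in> S"
      by (simp add: group_add_normalize del: add_uminus_conv_diff)
  qed
  then show "S = UNIV" by blast
qed

lemma generates_f2: "generates (f2_letter (GX, False)) (f2_letter (GY, False))"
  unfolding generates_def
proof (intro allI impI)
  fix S :: "f2 set"
  assume S: "subgroup_closed S" "f2_letter (GX, False) \<in> S" "f2_letter (GY, False) \<in> S"
  have letters: "f2_letter a \<in> S" for a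
    using S by (cases a rule: prod.exhaust; cases "fst a"; cases "snd a")
      (auto simp: f2_letter_GX_GY subgroup_closed_uminus)
  have "0 \<in> S"
    using S subgroup_closed_add[OF S(1) S(2) subgroup_closed_uminus[OF S(1) S(2)]] by simp
  then have "sum_list (map f2_letter w) \<in> S" for w
    by (induction w) (auto simp: letters subgroup_closed_add[OF S(1)])
  then show "S = UNIV"
    by (metis UNIV_eq_I sum_list_f2_letter)
qed

definition pair_letter :: "'a::group_add \<Rightarrow> 'a \<Rightarrow> letter \<Rightarrow> 'a" where
  "pair_letter u v a = (let g = (case fst a of GX \<Rightarrow> u | GY \<Rightarrow> v) in if snd a then - g else g)"

lemma pair_letter_inv: "pair_letter u v (letter_inv a) = - pair_letter u v a"
  by (simp add: pair_letter_def letter_inv_def Let_def)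

lemma generates_imp_word:
  assumes "generates u v"
  obtains w where "reduced w" "sum_list (map (pair_letter u v) w) = g"
proof -
  let ?ev = "\<lambda>w. sum_list (map (pair_letter u v) w)"
  let ?S = "?ev ` {w. reduced w}"
  have "subgroup_closed ?S"
    unfolding subgroup_closed_def
  proof (intro conjI ballI)
    fix a assume "a \<in> ?S"
    then obtain w where "reduced w" "a = ?ev w" by blast
    then show "- a \<in> ?S"
      by (intro image_eqI[of _ _ "rev (map letter_inv w)"])
        (simp_all only: sum_list_rev_inv[where e = "pair_letter u v", OF pair_letter_inv]
          mem_Collect_eq reduced_rev_inv)
  next
    fix a b assume "a \<in> ?S" "b \<in> ?S"
    then obtain w x where "reduced w" "a = ?ev w" "reduced x" "b = ?ev x" by blast
    then show "a + b \<in> ?S"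
      by (intro image_eqI[of _ _ "foldr letter_mult w x"])
        (simp_all only: sum_list_foldr_letter_mult[where e = "pair_letter u v", OF pair_letter_inv]
          mem_Collect_eq reduced_foldr)
  qed
  moreover have "u \<in> ?S" by (rule image_eqI[of _ _ "[(GX, False)]"]) (auto simp: pair_letter_def reduced_def)
  moreover have "v \<in> ?S" by (rule image_eqI[of _ _ "[(GY, False)]"]) (auto simp: pair_letter_def reduced_def)
  ultimately have "?S = UNIV"
    using assms unfolding generates_def by blast
  then have "g \<in> ?S" by blast
  then show thesis using that by blast
qed

text \<open>Nielsen's criterion: every factor keeps an uncancelled core, because its two neighbours
  together consume less than its length. The second conjunct carries the induction: the product
  begins with exactly the part of the first factor that the next factor does not cancel. In
  particular an element of length 1 can only be a single factor.\<close>

lemma reduced_sum_length: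
  fixes e :: "letter \<Rightarrow> f2"
  assumes pos: "\<And>a. e a \<noteq> 0"
    and half: "\<And>a b. b \<noteq> letter_inv a \<Longrightarrow>
      2 * common (- e a) (e b) \<le> len (e a) \<and> 2 * common (- e a) (e b) \<le> len (e b)"
    and mid: "\<And>a b c. b \<noteq> letter_inv a \<Longrightarrow> c \<noteq> letter_inv b \<Longrightarrow>
      common (- e a) (e b) + common (- e b) (e c) < len (e b)"
    and "reduced (a # w)"
  shows "len (sum_list (map e (a # w))) \<ge> (if w = [] then 1 else 2) \<and>
    common (sum_list (map e (a # w))) (e a) + (if w = [] then 0 else common (- e a) (e (hd w))) = len (e a)"
  using assms(4)
proof (induction w arbitrary: a)
  case Nil
  have "common (e a) (e a) = len (e a)"
    using len_uminus_add[of "e a" "e a"] by simp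
  moreover have "len (e a) > 0" using pos[of a] len_0_iff[of "e a"] by blast
  ultimately show ?case by simp
next
  case (Cons b s)
  define g where "g = sum_list (map e (b # s))"
  have ba: "b \<noteq> letter_inv a" and red: "reduced (b # s)"
    using Cons.prems by (auto simp: reduced_def)
  have IH: "common g (e b) + (if s = [] then 0 else common (- e b) (e (hd s))) = len (e b)"
    using Cons.IH[OF red] by (simp add: g_def)
  \<comment> \<open>What \<open>e a\<close> cancels in \<open>e b\<close> lies inside the prefix of
    \<open>e b\<close> that survives in \<open>g\<close>, so \<open>e a\<close> cancels against
    \<open>g\<close> exactly as it does against \<open>e b\<close> alone.\<close>
  have "common (- e a) (e b) < common (e b) g"
  proof (cases s)
    case Nil
    have "len (e b) > 0" using pos[of b] len_0_iff[of "e b"] by blast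
    then show ?thesis using half[OF ba] IH Nil by (simp add: common_commute)
  next
    case s: (Cons c s')
    then have "c \<noteq> letter_inv b" using red by (auto simp: reduced_def)
    with mid[OF ba this] IH s show ?thesis by (simp add: common_commute)
  qed
  then have cg: "common (- e a) g = common (- e a) (e b)" "common (- e a) (e b) < len g"
    using common_less[of "- e a" "e b" g] common_le[of "e b" g] by auto
  have l: "len (e a + g) + 2 * common (- e a) (e b) = len (e a) + len g"
    using len_add[of "e a" g] cg by simp
  have la: "len (e a) > 0" using pos[of a] len_0_iff[of "e a"] by blast
  have "len (- (e a + g) + e a) = len g"
    by (simp add: minus_add add.assoc)
  then have "common (e a + g) (e a) + common (- e a) (e b) = len (e a)"
    using len_uminus_add[of "e a + g" "e a"] l by simp
  moreover have "len (e a + g) \<ge> 2"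
    using l cg(2) half[OF ba] la by linarith
  ultimately show ?case by (simp add: g_def)
qed

lemma f2_letter_neq: "f2_letter (GX, False) \<noteq> f2_letter (GY, False)"
    "f2_letter (GX, False) \<noteq> - f2_letter (GY, False)"
  by (transfer; simp add: letter_inv_def)+

lemma len_f2_letter: "len (f2_letter a) = 1"
  by (simp add: len_def f2_letter.rep_eq)

text \<open>A group generated by one element is abelian, which follows from two applications of
  centralizers; the free group on two letters is not.\<close>

lemma generates_nonzero:
  assumes "generates u (v::f2)"
  shows "v \<noteq> 0"
proof
  assume v: "v = 0"
  have closed: "subgroup_closed {x. x + g = g + x}" for g :: f2
    unfolding subgroup_closed_def
  proof (intro conjI ballI; simp)
    fix a assume a: "a + g = g + a"
    have "- a + g = - a + (g + a) - a"
      by (simp add: group_add_normalize del: add_uminus_conv_diff)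
    also have "\<dots> = - a + (a + g) - a" by (simp only: a)
    also have "\<dots> = g - a" by simp
    finally show "- a + g = g - a" .
  next
    fix a b assume a: "a + g = g + a" and b: "b + g = g + b"
    have "a + b + g = a + g + b" using b by (simp add: add.assoc)
    then show "a + b + g = g + (a + b)" using a by (simp add: add.assoc)
  qed
  have "{x. x + u = u + x} = UNIV"
    using assms v closed[of u] by (auto simp: generates_def)
  then have "x + u = u + x" for x by blast
  then have "u \<in> {x. x + g = g + x}" for g by auto
  then have "{x. x + g = g + x} = UNIV" for g :: f2
    using assms v closed[of g] by (auto simp: generates_def)
  then have "f2_letter (GX, False) + f2_letter (GY, False) = f2_letter (GY, False) + f2_letter (GX, False)"
    by blast
  then show False
    by transfer (simp add: letter_mult_def letter_inv_def)
qed

text \<open>Nielsen reduction of the total length. Elementary moves alone may get stuck when exactly half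
  of one element cancels on both sides; in that case a simultaneous conjugation shortens the pair.\<close>

theorem generates_imp_farey_basis:
  assumes "generates u v"
  shows "farey_basis (f2_letter (GX, False)) (f2_letter (GY, False)) u v" (is "?B u v")
  using assms
proof (induction "len u + len v" arbitrary: u v rule: less_induct)
  case less
  note gen = less.prems
  have nz: "u \<noteq> 0" "v \<noteq> 0"
    using generates_nonzero gen generates_swap by blast+
  define e where "e = pair_letter u v"
  have e_inv: "e (letter_inv a) = - e a" for a
    by (simp add: e_def pair_letter_inv)
  have e_cases: "e a \<in> (case fst a of GX \<Rightarrow> {u, - u} | GY \<Rightarrow> {v, - v})" for a
    by (simp add: e_def pair_letter_def split: gen.split)
  have e_nz: "e a \<noteq> 0" for a
    using e_cases[of a] nz by (auto split: gen.splits)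
  have B_e: "?B (e a) (e b) \<longleftrightarrow> ?B u v" and gen_e: "generates (e a) (e b)"
    and len_e: "len (e a) + len (e b) = len u + len v" if "fst a \<noteq> fst b" for a b
  proof -
    show "?B (e a) (e b) \<longleftrightarrow> ?B u v"
      using e_cases[of a] e_cases[of b] that farey_basis_swap
      by (auto split: gen.splits simp: farey_basis_uminus_iff)
    show "generates (e a) (e b)"
      using e_cases[of a] e_cases[of b] that gen
      by (auto split: gen.splits simp: generates_uminus_iff intro: generates_swap)
    show "len (e a) + len (e b) = len u + len v"
      using e_cases[of a] e_cases[of b] that by (auto split: gen.splits)
  qed
  show ?case
  proof (rule ccontr)
    assume notB: "\<not> ?B u v"
    \<comment> \<open>A shortening move would finish by induction, since \<open>farey_basis\<close>
      is invariant under elementary moves.\<close>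
    have N1: "len (e a + e b) \<ge> len (e a) \<and> len (e a + e b) \<ge> len (e b)"
      if "fst a \<noteq> fst b" for a b
    proof -
      have "\<not> len (e a + e b) < len (e a)"
        using less.hyps[of "e a + e b" "e b"] generates_add_left[OF gen_e[OF that]] len_e[OF that]
          B_e[OF that] notB by (auto simp: farey_basis_add_left_iff)
      moreover have "\<not> len (e a + e b) < len (e b)"
        using less.hyps[of "e a" "e a + e b"] generates_add_right[OF gen_e[OF that]] len_e[OF that]
          B_e[OF that] notB by (auto simp: farey_basis_add_right_iff)
      ultimately show ?thesis by simp
    qed
    have half: "2 * common (- e a) (e b) \<le> len (e a) \<and> 2 * common (- e a) (e b) \<le> len (e b)"
      if "fst a \<noteq> fst b" for a b
      using N1[OF that] len_add[of "e a" "e b"] by linarith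
    have same: "2 * common (- e a) (e b) < len (e b) \<and> len (e a) = len (e b)"
      if "fst a = fst b" "b \<noteq> letter_inv a" for a b
    proof -
      have "a = b" using that by (auto simp: letter_inv_def prod_eq_iff)
      then show ?thesis using common_uminus_self[OF e_nz[of a]] by (simp add: common_commute)
    qed
    \<comment> \<open>Failure forces exactly half of \<open>e b\<close> to cancel on each side, with
      both neighbours belonging to the other generator.\<close>
    have mid: "common (- e a) (e b) + common (- e b) (e c) < len (e b)"
      if ab: "b \<noteq> letter_inv a" and bc: "c \<noteq> letter_inv b" for a b c
    proof (rule ccontr)
      assume "\<not> ?thesis"
      moreover have "2 * common (- e a) (e b) \<le> len (e b) \<and> (fst a = fst b \<longrightarrow> 2 * common (- e a) (e b) < len (e b))"
        using half[of a b] same[of a b] ab by fastforce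
      moreover have "2 * common (- e b) (e c) \<le> len (e b) \<and> (fst b = fst c \<longrightarrow> 2 * common (- e b) (e c) < len (e b))"
        using half[of b c] same[of b c] bc by fastforce
      ultimately have neq: "fst a \<noteq> fst b" "fst b \<noteq> fst c"
        and eq: "2 * common (- e a) (e b) = len (e b)" "2 * common (- e b) (e c) = len (e b)"
        by auto
      have "fst a = fst c" using neq by (cases "fst a"; cases "fst b"; cases "fst c") auto
      then consider "c = a" | "c = letter_inv a"
        by (auto simp: letter_inv_def prod_eq_iff)
      then show False
      proof cases
        \<comment> \<open>Equal neighbours are the stuck case: a conjugate of the pair
          \<open>e b\<close>, \<open>e b + e a\<close> is strictly shorter.\<close>
        case 1
        have "len (e b) \<le> len (e a)" using half[OF neq(1)] eq by linarith
        then obtain p where p: "len (- p + e b + p) \<le> len (e b)"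
          "len (- p + (e b + e a) + p) + len (e b) \<le> len (e a)"
          using conj_shortens[of "e a" "e b"] eq 1 by auto
        have "len (e b) > 0" using e_nz[of b] len_0_iff[of "e b"] by blast
        then have "len (- p + e b + p) + len (- p + (e b + e a) + p) < len u + len v"
          using p len_e[OF neq(1)] by linarith
        moreover have g: "generates (e b) (e b + e a)"
          using generates_add_right[OF gen_e[OF neq(1)[symmetric]]] .
        have "generates (- p + e b + p) (- p + (e b + e a) + p)"
          using generates_conj[OF g, of "- p"] by simp
        ultimately have "?B (- p + e b + p) (- p + (e b + e a) + p)"
          using less.hyps by blast
        then have "?B (e b) (e b + e a)"
          using farey_basis_conj_iff[of _ _ "- p" "e b" "e b + e a"] by simp
        then have "?B (e b) (e a)"
          by (simp add: farey_basis_add_right_iff)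
        then show False using B_e[OF neq(1)[symmetric]] notB by simp
      next
        \<comment> \<open>Inverse neighbours: \<open>e b\<close> and \<open>- e b\<close> both share
          half their length with \<open>- e a\<close>, so by the ultrametric inequality
          \<open>e b\<close> overlaps its own inverse in half its length.\<close>
        case 2
        then have "common (e b) (- e b) \<ge> min (common (e b) (- e a)) (common (- e a) (- e b))"
          by (intro common_min)
        moreover have "common (e b) (- e a) = common (- e a) (e b)"
          "common (- e a) (- e b) = common (- e b) (e c)"
          using 2 e_inv[of a] by (simp_all add: common_commute)
        ultimately show False
          using common_uminus_self[OF e_nz[of b]] eq by simp
      qed
    qed
    have half': "2 * common (- e a) (e b) \<le> len (e a) \<and> 2 * common (- e a) (e b) \<le> len (e b)"
      if "b \<noteq> letter_inv a" for a b
      using half[of a b] same[of a b] that by fastforce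
    \<comment> \<open>The pair is now Nielsen reduced, so a generator of the free group, having
      length 1, is one of \<open>u\<close>, \<open>v\<close> or an inverse of them.\<close>
    have letter: "\<exists>b. f2_letter a = e b" for a
    proof -
      obtain w where w: "reduced w" "sum_list (map e w) = f2_letter a"
        using generates_imp_word[OF gen] unfolding e_def by blast
      obtain b w' where bw: "w = b # w'"
        using w(2) len_f2_letter[of a] by (cases w) auto
      have "w' = []"
        using reduced_sum_length[of e b w', OF e_nz half' mid] w len_f2_letter[of a]
        unfolding bw by (auto split: if_splits)
      with bw w(2) show ?thesis by (intro exI[of _ b]) simp
    qed
    obtain b c where bc: "f2_letter (GX, False) = e b" "f2_letter (GY, False) = e c"
      using letter[of "(GX, False)"] letter[of "(GY, False)"] by blast
    have "fst b \<noteq> fst c"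
    proof
      assume "fst b = fst c"
      then have "b = c \<or> c = letter_inv b" by (auto simp: letter_inv_def prod_eq_iff)
      then show False using bc f2_letter_neq e_inv[of b] by auto
    qed
    from B_e[OF this] have "?B u v \<longleftrightarrow> ?B (f2_letter (GX, False)) (f2_letter (GY, False))"
      using bc by simp
    with notB show False
      using farey_imp_farey_basis farey.base by blast
  qed
qed

section \<open>Trace polynomials\<close>

text \<open>\<open>eval3\<close> nests three evaluations, and the coefficient map of each outer one
  is again an evaluation. Lemmas about an arbitrary additive and multiplicative map serve all
  levels.\<close>

context
  fixes f :: "'a::comm_ring_1 \<Rightarrow> 'b::comm_ring_1"
  assumes f_0: "f 0 = 0" and f_add: "\<And>a b. f (a + b) = f a + f b"
    and f_mult: "\<And>a b. f (a * b) = f a * f b"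
begin

lemma poly_map_poly_pCons: "poly (map_poly f (pCons a p)) c = f a + c * poly (map_poly f p) c"
  by (simp add: map_poly_pCons f_0)

lemma poly_map_poly_add:
  "poly (map_poly f (p + q)) c = poly (map_poly f p) c + poly (map_poly f q) c"
  by (induction p q rule: poly_induct2) (simp_all add: poly_map_poly_pCons f_add algebra_simps)

lemma poly_map_poly_smult: "poly (map_poly f (smult a p)) c = f a * poly (map_poly f p) c"
  by (induction p) (simp_all add: poly_map_poly_pCons f_mult algebra_simps)

lemma poly_map_poly_mult:
  "poly (map_poly f (p * q)) c = poly (map_poly f p) c * poly (map_poly f q) c"
  by (induction p)
    (simp_all add: poly_map_poly_pCons poly_map_poly_add poly_map_poly_smult f_0 algebra_simps)

end

lemma eval3_0 [simp]: "eval3 0 x y z = 0"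
  by (simp add: eval3_def)

lemma eval3_pCons:
  "eval3 (pCons Q P) x y z =
    poly (map_poly (\<lambda>R. poly (map_poly of_int R) x) Q) y + z * eval3 P x y z"
  by (simp add: eval3_def map_poly_pCons)

lemma eval3_const [simp]: "eval3 [:[:[:c:]:]:] x y z = of_int c"
  by (simp add: eval3_def map_poly_pCons)

lemma eval3_1 [simp]: "eval3 1 x y z = 1"
  using eval3_const[of 1] by (simp add: one_pCons)

type_synonym poly3 = "int poly poly poly"

definition var_x :: poly3 where "var_x = [:[:[:0, 1:]:]:]"

definition var_y :: poly3 where "var_y = [:[:0, 1:]:]"

definition var_z :: poly3 where "var_z = [:0, 1:]"

lemma eval3_vars [simp]: "eval3 var_x x y z = x" "eval3 var_y x y z = y" "eval3 var_z x y z = z"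
  by (simp_all add: eval3_def map_poly_pCons var_x_def var_y_def var_z_def)

lemma eval3_add [simp]: "eval3 (P + Q) x y z = eval3 P x y z + eval3 Q x y z"
  unfolding eval3_def
  by (intro poly_map_poly_add) (simp_all add: poly_map_poly_add poly_map_poly_mult)

lemma eval3_mult [simp]: "eval3 (P * Q) x y z = eval3 P x y z * eval3 Q x y z"
  unfolding eval3_def
  by (intro poly_map_poly_mult) (simp_all add: poly_map_poly_add poly_map_poly_mult)

lemma eval3_2 [simp]: "eval3 2 x y z = 2"
  using eval3_add[of 1 1 x y z] by simp

lemma eval3_uminus [simp]: "eval3 (- P) x y z = - eval3 P x y z"
  using eval3_add[of P "- P" x y z] by (simp add: eq_neg_iff_add_eq_0 add.commute)

lemma eval3_diff [simp]: "eval3 (P - Q) x y z = eval3 P x y z - eval3 Q x y z"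
  using eval3_add[of P "- Q" x y z] by simp

lemma eval3_of_int:
  "eval3 P (of_int x) (of_int y) (of_int z) = (of_int (eval3 P x y z) :: 'a::comm_ring_1)"
proof -
  have 1: "poly (map_poly of_int R) (of_int x) = (of_int (poly (map_poly of_int R) x) :: 'a)"
    for R :: "int poly"
    by (induction R) (simp_all add: map_poly_pCons)
  have 2: "poly (map_poly (\<lambda>R. poly (map_poly of_int R) (of_int x)) Q) (of_int y) =
      (of_int (poly (map_poly (\<lambda>R. poly (map_poly of_int R) x) Q) y) :: 'a)" for Q :: "int poly poly"
    by (induction Q) (simp_all add: map_poly_pCons 1)
  show ?thesis
    by (induction P) (simp_all add: eval3_pCons 2)
qed

lemma eval3_cong_mod:
  assumes "[x = x'] (mod m)" "[y = y'] (mod m)" "[z = z'] (mod (m::int))"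
  shows "[eval3 P x y z = eval3 P x' y' z'] (mod m)"
proof -
  have 1: "[poly (map_poly of_int R) x = poly (map_poly of_int R) x'] (mod m)" for R :: "int poly"
    by (induction R) (simp_all add: map_poly_pCons cong_add cong_mult assms)
  have 2: "[poly (map_poly (\<lambda>R. poly (map_poly of_int R) x) Q) y =
      poly (map_poly (\<lambda>R. poly (map_poly of_int R) x') Q) y'] (mod m)" for Q :: "int poly poly"
    by (induction Q) (simp_all add: map_poly_pCons cong_add cong_mult assms 1[simplified])
  show ?thesis
    by (induction P) (simp_all add: eval3_pCons cong_add cong_mult assms 2[simplified])
qed

text \<open>A polynomial that vanishes on an infinite domain is zero; this is applied to z, then to
  y, then to x.\<close>

lemma eval3_eq_0_imp_eq_0:
  assumes "\<And>x y z :: 'a :: {idom, ring_char_0}. eval3 P x y z = 0"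
  shows "P = 0"
proof -
  define h1 :: "'a \<Rightarrow> int poly \<Rightarrow> 'a" where "h1 = (\<lambda>x R. poly (map_poly of_int R) x)"
  define h2 :: "'a \<Rightarrow> 'a \<Rightarrow> int poly poly \<Rightarrow> 'a" where "h2 = (\<lambda>x y Q. poly (map_poly (h1 x) Q) y)"
  have h0: "h1 x 0 = 0" "h2 x y 0 = 0" for x y
    by (simp_all add: h1_def h2_def)
  have R: "R = 0" if "\<And>x. h1 x R = 0" for R
  proof -
    have "map_poly of_int R = (0 :: 'a poly)"
      using that unfolding h1_def by (simp flip: poly_all_0_iff_0)
    then show "R = 0"
      by (auto simp: poly_eq_iff coeff_map_poly)
  qed
  have Q: "Q = 0" if "\<And>x y. h2 x y Q = 0" for Q
  proof -
    have "map_poly (h1 x) Q = 0" for x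
      using that unfolding h2_def by (simp flip: poly_all_0_iff_0)
    then have "h1 x (coeff Q i) = 0" for x i
      by (metis coeff_0 coeff_map_poly h0(1))
    then have "coeff Q i = 0" for i using R by blast
    then show "Q = 0" by (simp add: poly_eq_iff)
  qed
  have "map_poly (h2 x y) P = 0" for x y
    using assms unfolding h2_def h1_def eval3_def by (simp flip: poly_all_0_iff_0)
  then have "h2 x y (coeff P i) = 0" for x y i
    by (metis coeff_0 coeff_map_poly h0(2))
  then have "coeff P i = 0" for i using Q by blast
  then show "P = 0" by (simp add: poly_eq_iff)
qed

section \<open>Two-by-two matrices and Fricke's trace identities\<close>

definition adj2 :: "'a::comm_ring_1^2^2 \<Rightarrow> 'a^2^2" where
  "adj2 A = vector [vector [A $ 2 $ 2, - A $ 1 $ 2], vector [- A $ 2 $ 1, A $ 1 $ 1]]"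

lemma adj2_nth [simp]:
  "adj2 A $ 1 $ 1 = A $ 2 $ 2" "adj2 A $ 1 $ 2 = - A $ 1 $ 2"
  "adj2 A $ 2 $ 1 = - A $ 2 $ 1" "adj2 A $ 2 $ 2 = A $ 1 $ 1"
  by (simp_all add: adj2_def)

lemma matrix2_mult_nth: "((A::'a::comm_ring_1^2^2) ** B) $ i $ j = A $ i $ 1 * B $ 1 $ j + A $ i $ 2 * B $ 2 $ j"
  by (simp add: matrix_matrix_mult_def sum_2)

lemma trace2: "trace (A::'a::comm_ring_1^2^2) = A $ 1 $ 1 + A $ 2 $ 2"
  by (simp add: trace_def sum_2)

lemma matrix2_eq_iff: "(A::'a^2^2) = B \<longleftrightarrow> A $ 1 $ 1 = B $ 1 $ 1 \<and> A $ 1 $ 2 = B $ 1 $ 2 \<and>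
  A $ 2 $ 1 = B $ 2 $ 1 \<and> A $ 2 $ 2 = B $ 2 $ 2"
  by (auto simp: vec_eq_iff forall_2)

lemma mat2_nth [simp]: "(mat c :: 'a::comm_ring_1^2^2) $ 1 $ 1 = c" "(mat c :: 'a^2^2) $ 2 $ 2 = c"
  "(mat c :: 'a^2^2) $ 1 $ 2 = 0" "(mat c :: 'a^2^2) $ 2 $ 1 = 0"
  by (simp_all add: mat_def)

lemma mult_adj2:
  assumes "det (A::'a::comm_ring_1^2^2) = 1"
  shows "A ** adj2 A = mat 1" "adj2 A ** A = mat 1"
  using assms by (simp_all add: matrix2_eq_iff matrix2_mult_nth det_2 algebra_simps)

lemma matrix_inv_eq_adj2:
  assumes "det (A::'a::comm_ring_1^2^2) = 1"
  shows "matrix_inv A = adj2 A"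
proof -
  have "A ** matrix_inv A = mat 1 \<and> matrix_inv A ** A = mat 1"
    unfolding matrix_inv_def by (rule someI[of _ "adj2 A"]) (simp add: mult_adj2[OF assms])
  then have "matrix_inv A = matrix_inv A ** (A ** adj2 A)" "matrix_inv A ** A ** adj2 A = adj2 A"
    by (simp_all add: mult_adj2[OF assms])
  then show ?thesis
    by (simp add: matrix_mul_assoc)
qed

text \<open>The adjugate stands in for the inverse, so that words can be evaluated in any
  commutative ring, also where the determinant is 1 only modulo \<open>m\<close>.\<close>

definition letter_mat :: "'a::comm_ring_1^2^2 \<Rightarrow> 'a^2^2 \<Rightarrow> letter \<Rightarrow> 'a^2^2" where
  "letter_mat A B a = (let L = (case fst a of GX \<Rightarrow> A | GY \<Rightarrow> B) in if snd a then adj2 L else L)"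

definition word_mat :: "'a::comm_ring_1^2^2 \<Rightarrow> 'a^2^2 \<Rightarrow> letter list \<Rightarrow> 'a^2^2" where
  "word_mat A B w = foldr (\<lambda>a M. letter_mat A B a ** M) w (mat 1)"

lemma word_mat_simps [simp]: "word_mat A B [] = mat 1"
  "word_mat A B (a # w) = letter_mat A B a ** word_mat A B w"
  by (simp_all add: word_mat_def)

lemma word_eval_eq_word_mat:
  assumes "det A = 1" "det B = 1"
  shows "word_eval A B w = word_mat A B w"
  unfolding word_eval_def word_mat_def
  by (intro foldr_cong refl)
    (auto simp: letter_mat_def Let_def matrix_inv_eq_adj2 assms split: gen.splits)

text \<open>A quadruple \<open>(p, q, r, s)\<close> stands for \<open>p + q A + r B + s A B\<close>. Left multiplication by \<open>B\<close> is
  expressed through $AB + BA = xB + yA + (z - xy)$, the polarized Cayley-Hamilton identity.\<close>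

definition fricke_mult :: "letter \<Rightarrow> poly3 \<times> poly3 \<times> poly3 \<times> poly3 \<Rightarrow> poly3 \<times> poly3 \<times> poly3 \<times> poly3" where
  "fricke_mult a = (\<lambda>(p, q, r, s).
    let x = var_x; y = var_y; z = var_z;
        k = (q * (z - x * y) - r - s * x, q * y + s, p + q * x + r * y + s * z, - q)
    in case a of
      (GX, False) \<Rightarrow> (- q, p + x * q, - s, r + x * s)
    | (GX, True) \<Rightarrow> (x * p + q, - p, x * r + s, - r)
    | (GY, False) \<Rightarrow> k
    | (GY, True) \<Rightarrow> (case k of (p', q', r', s') \<Rightarrow> (y * p - p', y * q - q', y * r - r', y * s - s')))"

definition fricke :: "letter list \<Rightarrow> poly3 \<times> poly3 \<times> poly3 \<times> poly3" where
  "fricke w = foldr fricke_mult w (1, 0, 0, 0)"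

definition fricke_trace :: "letter list \<Rightarrow> poly3" where
  "fricke_trace w = (case fricke w of (p, q, r, s) \<Rightarrow>
    2 * p + q * var_x + r * var_y + s * var_z)"

definition lin4 :: "'a::comm_ring_1^2^2 \<Rightarrow> 'a^2^2 \<Rightarrow> 'a \<Rightarrow> 'a \<Rightarrow> 'a \<Rightarrow> 'a \<Rightarrow> 'a^2^2" where
  "lin4 A B p q r s =
    (\<chi> i j. p * mat 1 $ i $ j + q * A $ i $ j + r * B $ i $ j + s * (A ** B) $ i $ j)"

definition fricke_mat :: "'a::comm_ring_1^2^2 \<Rightarrow> 'a^2^2 \<Rightarrow> poly3 \<times> poly3 \<times> poly3 \<times> poly3 \<Rightarrow> 'a^2^2" where
  "fricke_mat A B = (\<lambda>(p, q, r, s). let e = (\<lambda>P. eval3 P (trace A) (trace B) (trace (A ** B))) in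
    lin4 A B (e p) (e q) (e r) (e s))"

text \<open>Cayley-Hamilton and its polarized form with their exact defects, multiples of
  \<open>det A - 1\<close> and \<open>det B - 1\<close>. Keeping the defect is what allows the
  reduction modulo \<open>m\<close>.\<close>

lemma lin4_mult_left:
  "(A ** lin4 A B p q r s) $ i $ j - lin4 A B (- q) (p + trace A * q) (- s) (r + trace A * s) $ i $ j =
    (det A - 1) * (- q * mat 1 $ i $ j - s * B $ i $ j)" (is ?th1)
  "(B ** lin4 A B p q r s) $ i $ j - lin4 A B (q * (trace (A ** B) - trace A * trace B) - r - s * trace A)
      (q * trace B + s) (p + q * trace A + r * trace B + s * trace (A ** B)) (- q) $ i $ j =
    (det B - 1) * (s * (A $ i $ j - trace A * mat 1 $ i $ j) - r * mat 1 $ i $ j)" (is ?th2)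
proof -
  consider "i = 1" "j = 1" | "i = 1" "j = 2" | "i = 2" "j = 1" | "i = 2" "j = 2"
    using exhaust_2[of i] exhaust_2[of j] by blast
  then show ?th1
    by cases (simp_all add: lin4_def matrix2_mult_nth trace2 det_2 algebra_simps)
  consider "i = 1" "j = 1" | "i = 1" "j = 2" | "i = 2" "j = 1" | "i = 2" "j = 2"
    using exhaust_2[of i] exhaust_2[of j] by blast
  then show ?th2
    by cases (simp_all add: lin4_def matrix2_mult_nth trace2 det_2 algebra_simps)
qed

lemma adj2_mult_nth: "(adj2 A ** M) $ i $ j = trace A * M $ i $ j - (A ** M) $ i $ j"
  using exhaust_2[of i] by (auto simp: matrix2_mult_nth trace2 algebra_simps)

lemma lin4_diff: "c * lin4 A B p q r s $ i $ j - lin4 A B p' q' r' s' $ i $ j =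
    lin4 A B (c * p - p') (c * q - q') (c * r - r') (c * s - s') $ i $ j"
  by (simp add: lin4_def algebra_simps)

lemma fricke_mult_dvd:
  fixes A B :: "'a::comm_ring_1^2^2"
  assumes "m dvd det A - 1" "m dvd det B - 1"
  shows "m dvd (letter_mat A B a ** fricke_mat A B k) $ i $ j - fricke_mat A B (fricke_mult a k) $ i $ j"
proof -
  obtain p q r s where k: "k = (p, q, r, s)" by (cases k)
  obtain g b where a: "a = (g, b)" by (cases a)
  let ?e = "\<lambda>P. eval3 P (trace A) (trace B) (trace (A ** B))"
  have F: "fricke_mat A B (p, q, r, s) = lin4 A B (?e p) (?e q) (?e r) (?e s)" for p q r s
    by (simp add: fricke_mat_def)
  note step = lin4_mult_left[where A = A and B = B and p = "?e p" and q = "?e q" and r = "?e r"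
      and s = "?e s" and i = i and j = j]
  have pos: "m dvd (letter_mat A B (g, False) ** fricke_mat A B k) $ i $ j
      - fricke_mat A B (fricke_mult (g, False) k) $ i $ j"
  proof (cases g)
    case GX
    have "fricke_mat A B (fricke_mult (g, False) k) = lin4 A B (- ?e q) (?e p + trace A * ?e q) (- ?e s)
        (?e r + trace A * ?e s)"
      by (simp add: GX k F fricke_mult_def)
    then show ?thesis
      using assms(1) by (simp only: GX k F letter_mat_def fst_conv snd_conv Let_def gen.case if_False step dvd_mult2)
  next
    case GY
    have "fricke_mat A B (fricke_mult (g, False) k) = lin4 A B
        (?e q * (trace (A ** B) - trace A * trace B) - ?e r - ?e s * trace A) (?e q * trace B + ?e s)
        (?e p + ?e q * trace A + ?e r * trace B + ?e s * trace (A ** B)) (- ?e q)"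
      by (simp add: GY k F fricke_mult_def)
    then show ?thesis
      using assms(2) by (simp only: GY k F letter_mat_def fst_conv snd_conv Let_def gen.case if_False step dvd_mult2)
  qed
  define L where "L = (case g of GX \<Rightarrow> A | GY \<Rightarrow> B)"
  \<comment> \<open>By Cayley-Hamilton the adjugate is trace minus matrix, so the defect of an
    inverse letter is the negative of the defect of the letter.\<close>
  have "(letter_mat A B (g, True) ** fricke_mat A B k) $ i $ j - fricke_mat A B (fricke_mult (g, True) k) $ i $ j
    = - ((letter_mat A B (g, False) ** fricke_mat A B k) $ i $ j
      - fricke_mat A B (fricke_mult (g, False) k) $ i $ j)"
  proof -
    have "fricke_mat A B (fricke_mult (g, True) k) $ i $ j =
      trace L * fricke_mat A B k $ i $ j - fricke_mat A B (fricke_mult (g, False) k) $ i $ j"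
      unfolding L_def
      by (cases g) (simp_all add: k F fricke_mult_def lin4_diff Let_def algebra_simps)
    then show ?thesis
      by (simp add: letter_mat_def L_def adj2_mult_nth)
  qed
  then have "m dvd (letter_mat A B (g, True) ** fricke_mat A B k) $ i $ j
      - fricke_mat A B (fricke_mult (g, True) k) $ i $ j"
    using pos by (simp only: dvd_minus_iff)
  with pos show ?thesis by (cases b) (simp_all add: a)
qed

lemma word_mat_fricke_dvd:
  fixes A B :: "'a::comm_ring_1^2^2"
  assumes "m dvd det A - 1" "m dvd det B - 1"
  shows "m dvd word_mat A B w $ i $ j - fricke_mat A B (fricke w) $ i $ j"
proof (induction w arbitrary: i j)
  case Nil
  show ?case
    by (simp add: fricke_def fricke_mat_def lin4_def)
next
  case (Cons a w)
  let ?L = "letter_mat A B a" and ?W = "word_mat A B w" and ?F = "fricke_mat A B (fricke w)"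
  have "(?L ** ?W) $ i $ j - fricke_mat A B (fricke (a # w)) $ i $ j =
     ?L $ i $ 1 * (?W $ 1 $ j - ?F $ 1 $ j) + ?L $ i $ 2 * (?W $ 2 $ j - ?F $ 2 $ j) +
     ((?L ** ?F) $ i $ j - fricke_mat A B (fricke_mult a (fricke w)) $ i $ j)"
    by (simp add: matrix2_mult_nth fricke_def algebra_simps)
  moreover have "m dvd \<dots>"
    by (intro dvd_add dvd_mult Cons.IH fricke_mult_dvd[OF assms])
  ultimately show ?case by simp
qed

lemma trace_lin4: "trace (lin4 A B p q r s) = 2 * p + q * trace A + r * trace B + s * trace (A ** B)"
  by (simp add: lin4_def trace2 algebra_simps)

lemma trace_fricke_mat:
  "trace (fricke_mat A B (fricke w)) = eval3 (fricke_trace w) (trace A) (trace B) (trace (A ** B))"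
proof -
  obtain p q r s where k: "fricke w = (p, q, r, s)" by (cases "fricke w")
  show ?thesis
    by (simp add: k fricke_mat_def trace_lin4 fricke_trace_def)
qed

text \<open>One polynomial computes traces exactly over the complex numbers (\<open>m = 0\<close>)
  and modulo p for integer matrices.\<close>

lemma trace_fricke_dvd:
  fixes A B :: "'a::comm_ring_1^2^2"
  assumes "m dvd det A - 1" "m dvd det B - 1"
  shows "m dvd trace (word_mat A B w) - eval3 (fricke_trace w) (trace A) (trace B) (trace (A ** B))"
proof -
  let ?W = "word_mat A B w" and ?F = "fricke_mat A B (fricke w)"
  have "trace ?W - trace ?F = (?W $ 1 $ 1 - ?F $ 1 $ 1) + (?W $ 2 $ 2 - ?F $ 2 $ 2)"
    by (simp add: trace2)
  then have "m dvd trace ?W - trace ?F"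
    using word_mat_fricke_dvd[OF assms] by (simp only: dvd_add)
  then show ?thesis
    by (simp only: trace_fricke_mat)
qed

text \<open>\<open>A\<close> is a companion matrix, and \<open>B\<close> is arranged so that
  \<open>trace (A ** B) = s + 1 / s\<close>; hence \<open>s\<close> is a root of
  \<open>s^2 - z s + 1\<close>.\<close>

lemma exists_SL2_traces:
  fixes x y z :: complex
  obtains A B :: "complex^2^2" where "det A = 1" "det B = 1" "trace A = x" "trace B = y"
    "trace (A ** B) = z"
proof -
  define s where "s = (z + csqrt (z\<^sup>2 - 4)) / 2"
  have s: "s * s - z * s + 1 = 0"
  proof -
    have "4 * (s * s - z * s + 1) = (csqrt (z\<^sup>2 - 4))\<^sup>2 - (z\<^sup>2 - 4)"
      by (simp add: s_def power2_eq_square field_simps)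
    then have "4 * (s * s - z * s + 1) = 0" by (simp only: power2_csqrt diff_self)
    then show ?thesis by (simp only: mult_eq_0_iff) simp
  qed
  then have "s \<noteq> 0" by auto
  then have z: "s + 1 / s = z" using s by (simp add: field_simps)
  define A :: "complex^2^2" where "A = vector [vector [x, -1], vector [1, 0]]"
  define B :: "complex^2^2" where "B = vector [vector [0, s], vector [- 1 / s, y]]"
  have "det A = 1" "det B = 1" "trace A = x" "trace B = y" "trace (A ** B) = z"
    using \<open>s \<noteq> 0\<close> z by (simp_all add: A_def B_def det_2 trace2 matrix2_mult_nth add.commute)
  then show thesis using that by blast
qed

lemma trace_word_eval_fricke:
  assumes "det A = 1" "det B = 1"
  shows "trace (word_eval A B w) = eval3 (fricke_trace w) (trace A) (trace B) (trace (A ** B))"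
  using trace_fricke_dvd[of 0 A B w] assms by (simp add: word_eval_eq_word_mat)

text \<open>Traces of pairs in SL2 fill the whole of complex 3-space, so a trace polynomial is
  unique and the definite description in \<open>trace_poly\<close> denotes it.\<close>

lemma trace_poly_eqI:
  assumes "\<And>A B. det A = 1 \<Longrightarrow> det B = 1 \<Longrightarrow>
     trace (word_eval A B w) = eval3 P (trace A) (trace B) (trace (A ** B))"
  shows "trace_poly w = P"
  unfolding trace_poly_def
proof (rule the_equality)
  fix Q
  assume Q: "\<forall>A B :: complex^2^2. det A = 1 \<and> det B = 1 \<longrightarrow>
     trace (word_eval A B w) = eval3 Q (trace A) (trace B) (trace (A ** B))"
  have "eval3 (Q - P) x y z = 0" for x y z :: complex
  proof -
    obtain A B :: "complex^2^2" where "det A = 1" "det B = 1" "trace A = x" "trace B = y"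
      "trace (A ** B) = z" by (rule exists_SL2_traces)
    then show ?thesis using assms[of A B] Q by simp
  qed
  then have "Q - P = 0" by (rule eval3_eq_0_imp_eq_0)
  then show "Q = P" by simp
qed (use assms in blast)

lemma trace_poly_eq_fricke_trace: "trace_poly w = fricke_trace w"
  by (rule trace_poly_eqI) (rule trace_word_eval_fricke)

lemma letter_mat_inv:
  "letter_mat A B (letter_inv a) = adj2 (letter_mat A B a)"
  by (cases a; cases "fst a"; cases "snd a")
    (auto simp: letter_mat_def letter_inv_def matrix2_eq_iff)

lemma det_letter_mat: "det A = 1 \<Longrightarrow> det B = 1 \<Longrightarrow> det (letter_mat A B a) = 1"
  by (auto simp: letter_mat_def Let_def det_2 mult.commute split: gen.split)

lemma det_word_mat: "det A = 1 \<Longrightarrow> det B = 1 \<Longrightarrow> det (word_mat A B w) = 1"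
  by (induction w) (simp_all add: det_mul det_letter_mat)

lemma word_mat_letter_mult:
  assumes "det A = 1" "det B = 1"
  shows "word_mat A B (letter_mult a w) = letter_mat A B a ** word_mat A B w"
  using mult_adj2[OF det_letter_mat[OF assms]]
  by (cases w) (auto simp: letter_mult_def letter_mat_inv matrix_mul_assoc)

lemma word_mat_foldr_letter_mult:
  assumes "det A = 1" "det B = 1"
  shows "word_mat A B (foldr letter_mult u v) = word_mat A B u ** word_mat A B v"
  by (induction u) (simp_all add: word_mat_letter_mult[OF assms] matrix_mul_assoc)

lemma word_mat_rev_inv:
  assumes "det A = 1" "det B = 1"
  shows "word_mat A B (rev (map letter_inv u)) = adj2 (word_mat A B u)"
proof -
  let ?i = "word_mat A B (rev (map letter_inv u))" and ?u = "word_mat A B u"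
  have "?i ** ?u = mat 1"
    using word_mat_foldr_letter_mult[OF assms, of "rev (map letter_inv u)" u]
    by (simp add: foldr_rev_inv)
  then have "?i ** ?u ** adj2 ?u = adj2 ?u" by simp
  then show ?thesis
    by (simp add: mult_adj2[OF det_word_mat[OF assms]] flip: matrix_mul_assoc)
qed

lemma word_mat_f2_add:
  assumes "det A = 1" "det B = 1"
  shows "word_mat A B (Rep_f2 (g + h)) = word_mat A B (Rep_f2 g) ** word_mat A B (Rep_f2 h)"
  by (simp add: plus_f2.rep_eq word_mat_foldr_letter_mult assms)

lemma word_mat_f2_uminus:
  assumes "det A = 1" "det B = 1"
  shows "word_mat A B (Rep_f2 (- g)) = adj2 (word_mat A B (Rep_f2 g))"
  by (simp add: uminus_f2.rep_eq word_mat_rev_inv assms)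

lemma word_mat_f2_sum_list:
  assumes "det A = 1" "det B = 1"
  shows "word_mat A B (Rep_f2 (sum_list (map f2_letter w))) = word_mat A B w"
  by (induction w) (simp_all add: zero_f2.rep_eq word_mat_f2_add[OF assms] f2_letter.rep_eq)

lemma trace_adj2: "trace (adj2 A) = trace A"
  by (simp add: trace2 add.commute)

lemma trace_mult_commute: "trace (A ** B) = trace (B ** (A::'a::comm_ring_1^2^2))"
  by (simp add: trace2 matrix2_mult_nth algebra_simps)

lemma trace_poly_cong:
  assumes "\<And>A B :: complex^2^2. det A = 1 \<Longrightarrow> det B = 1 \<Longrightarrow>
    trace (word_mat A B v) = trace (word_mat A B w)"
  shows "trace_poly v = trace_poly w"
  by (rule trace_poly_eqI)
    (simp add: word_eval_eq_word_mat assms trace_poly_eq_fricke_trace flip: trace_word_eval_fricke)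

lemma trace_poly_conj: "trace_poly (Rep_f2 (c + g - c)) = trace_poly (Rep_f2 g)"
proof (rule trace_poly_cong)
  fix A B :: "complex^2^2"
  assume *: "det A = 1" "det B = 1"
  have "trace (word_mat A B (Rep_f2 ((c + g) - c))) =
      trace (word_mat A B (Rep_f2 (c + g + - c)))" by simp
  also have "\<dots> = trace (word_mat A B (Rep_f2 (- c + (c + g))))"
    unfolding word_mat_f2_add[OF *] by (rule trace_mult_commute)
  finally show "trace (word_mat A B (Rep_f2 (c + g - c))) = trace (word_mat A B (Rep_f2 g))"
    by simp
qed

lemma trace_poly_uminus: "trace_poly (Rep_f2 (- g)) = trace_poly (Rep_f2 g)"
  by (rule trace_poly_cong) (simp add: word_mat_f2_uminus trace_adj2)

lemma trace_poly_sum_list: "trace_poly (Rep_f2 (sum_list (map f2_letter w))) = trace_poly w"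
  by (rule trace_poly_cong) (simp add: word_mat_f2_sum_list)

section \<open>Exponent sums, and words for members of a basis\<close>

definition letter_exp :: "gen \<Rightarrow> letter \<Rightarrow> int" where
  "letter_exp s a = (if fst a \<noteq> s then 0 else if snd a then -1 else 1)"

lemma letter_exp_inv: "letter_exp s (letter_inv a) = - letter_exp s a"
  by (simp add: letter_exp_def letter_inv_def)

lemma exp_sum_eq_sum_list: "exp_sum s w = sum_list (map (letter_exp s) w)"
  by (simp add: exp_sum_def letter_exp_def[abs_def])

lemma exp_sum_f2_add: "exp_sum s (Rep_f2 (g + h)) = exp_sum s (Rep_f2 g) + exp_sum s (Rep_f2 h)"
  by (simp add: exp_sum_eq_sum_list plus_f2.rep_eq
      sum_list_foldr_letter_mult[where e = "letter_exp s", OF letter_exp_inv])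

lemma exp_sum_f2_0: "exp_sum s (Rep_f2 0) = 0"
  by (simp add: exp_sum_eq_sum_list zero_f2.rep_eq)

lemma exp_sum_f2_uminus: "exp_sum s (Rep_f2 (- g)) = - exp_sum s (Rep_f2 g)"
  using exp_sum_f2_add[of s g "- g"] by (simp add: exp_sum_f2_0)

lemma exp_sum_f2_conj: "exp_sum s (Rep_f2 (c + g - c)) = exp_sum s (Rep_f2 g)"
  using exp_sum_f2_add[of s "c + g" "- c"] by (simp add: exp_sum_f2_add exp_sum_f2_uminus)

lemma exp_sum_f2_sum_list: "exp_sum s (Rep_f2 (sum_list (map f2_letter w))) = exp_sum s w"
  by (induction w)
    (simp_all add: exp_sum_f2_0 exp_sum_f2_add f2_letter.rep_eq, simp_all add: exp_sum_def)

definition count_Y :: "letter list \<Rightarrow> nat" where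
  "count_Y w = length (filter (\<lambda>a. fst a = GY) w)"

lemma exp_sum_GY_eq_count: "(GY, True) \<notin> set w \<Longrightarrow> exp_sum GY w = int (count_Y w)"
  by (induction w) (auto simp: exp_sum_def count_Y_def)

lemma farey_words:
  assumes "farey (f2_letter a) (f2_letter b) p q"
  shows "\<exists>v w. set v \<subseteq> {a, b} \<and> set w \<subseteq> {a, b} \<and>
    p = sum_list (map f2_letter v) \<and> q = sum_list (map f2_letter w)"
  using assms
proof induction
  case base
  show ?case by (rule exI[of _ "[a]"], rule exI[of _ "[b]"]) simp
next
  case (right p q)
  then obtain v w where "set v \<subseteq> {a, b}" "set w \<subseteq> {a, b}" "p = sum_list (map f2_letter v)"
    "q = sum_list (map f2_letter w)" by blast
  then show ?case by (intro exI[of _ v] exI[of _ "v @ w"]) simp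
next
  case (left p q)
  then obtain v w where "set v \<subseteq> {a, b}" "set w \<subseteq> {a, b}" "p = sum_list (map f2_letter v)"
    "q = sum_list (map f2_letter w)" by blast
  then show ?case by (intro exI[of _ "v @ w"] exI[of _ w]) simp
qed

text \<open>Farey pairs are positive words in X and Y or in X and Y^{-1}. In the second case
  inverting the word trades Y^{-1} for X^{-1} and keeps the trace. All letters Y then have the same
  sign, so their number is the absolute exponent sum.\<close>

lemma basis_trace_word:
  assumes "generates g v"
  obtains w where "(GY, True) \<notin> set w" "trace_poly (Rep_f2 g) = trace_poly w"
    "\<bar>exp_sum GY (Rep_f2 g)\<bar> = int (count_Y w)"
proof -
  obtain p q c where f: "farey (f2_letter (GX, False)) (f2_letter (GY, False)) p q \<or>
      farey (f2_letter (GX, False)) (f2_letter (GY, True)) p q"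
    and c: "conj_inverse c g p \<or> conj_inverse c g q"
    using generates_imp_farey_basis[OF assms] unfolding farey_basis_def f2_letter_GX_GY by blast
  define r where "r = (if conj_inverse c g p then p else q)"
  have r: "conj_inverse c g r" using c by (auto simp: r_def)
  obtain b u where u: "set u \<subseteq> {(GX, False), (GY, b)}" "r = sum_list (map f2_letter u)"
    using f farey_words unfolding r_def by (metis (full_types))
  define w where "w = (if b then rev (map letter_inv u) else u)"
  have w: "(GY, True) \<notin> set w"
    using u(1) by (cases b) (auto simp: w_def letter_inv_def)
  have "r = sum_list (map f2_letter w) \<or> r = - sum_list (map f2_letter w)"
    using sum_list_rev_inv[where e = f2_letter, OF f2_letter_inv, of u] u(2)
    by (cases b) (simp_all add: w_def)
  then have "conj_inverse c g (sum_list (map f2_letter w))"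
    using r by (auto simp: conj_inverse_def)
  then have "trace_poly (Rep_f2 g) = trace_poly w" "\<bar>exp_sum GY (Rep_f2 g)\<bar> = \<bar>exp_sum GY w\<bar>"
    unfolding conj_inverse_def
    by (auto simp only: trace_poly_conj trace_poly_uminus trace_poly_sum_list exp_sum_f2_conj
        exp_sum_f2_uminus exp_sum_f2_sum_list abs_minus_cancel)
  with w show thesis
    using that exp_sum_GY_eq_count[OF w] by simp
qed

section \<open>A curve on the surface\<close>

lemma finite_residues: "finite {t \<in> {0..<int p}. P t}"
  by (rule finite_subset[of _ "{0..<int p}"]) auto

text \<open>Lagrange's bound: synthetic division by a root \<open>c\<close> leaves the remainder
  \<open>poly f c\<close>, which is divisible by p, and the quotient inherits the leading
  coefficient.\<close>

lemma card_roots_mod_prime_le: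
  fixes f :: "int poly"
  assumes p: "prime p" and "\<not> int p dvd coeff f n" "degree f \<le> n"
  shows "card {t \<in> {0..<int p}. int p dvd poly f t} \<le> n"
  using assms(2,3)
proof (induction n arbitrary: f)
  case 0
  then have "f = [:coeff f 0:]" by (auto elim!: degree_eq_zeroE)
  then have "poly f t = coeff f 0" for t by (metis poly_pCons poly_0 mult_zero_right add.right_neutral)
  with 0 show ?case by simp
next
  case (Suc n)
  show ?case
  proof (cases "\<exists>t \<in> {0..<int p}. int p dvd poly f t")
    case True
    then obtain c where c: "c \<in> {0..<int p}" "int p dvd poly f c" by blast
    define g where "g = synthetic_div f c"
    have f: "f = [:- c, 1:] * g + [:poly f c:]"
      using synthetic_div_correct'[of c f] by (simp only: g_def)
    have deg: "degree g \<le> n"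
      using Suc.prems by (simp add: g_def degree_synthetic_div)
    have "coeff f (Suc n) = coeff g n - c * coeff g (Suc n)"
      by (subst f) simp
    then have "\<not> int p dvd coeff g n"
      using Suc.prems deg by (simp add: coeff_eq_0)
    then have IH: "card {t \<in> {0..<int p}. int p dvd poly g t} \<le> n"
      using Suc.IH deg by blast
    have "int p dvd poly g t" if "int p dvd poly f t" "t \<in> {0..<int p}" "t \<noteq> c" for t
    proof -
      have "poly f t = (t - c) * poly g t + poly f c"
        by (subst f) (simp add: algebra_simps)
      then have "int p dvd (t - c) * poly g t"
        using that(1) c(2) by (metis dvd_add_left_iff)
      moreover have "\<not> int p dvd t - c"
      proof
        assume "int p dvd t - c"
        then have "int p \<le> \<bar>t - c\<bar>"
          using that(3) by (intro zdvd_imp_le) auto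
        with that(2) c(1) show False by auto
      qed
      ultimately show ?thesis
        using p by (simp add: prime_dvd_mult_iff)
    qed
    then have "{t \<in> {0..<int p}. int p dvd poly f t} \<subseteq>
        insert c {t \<in> {0..<int p}. int p dvd poly g t}" by auto
    then have "card {t \<in> {0..<int p}. int p dvd poly f t} \<le>
        card (insert c {t \<in> {0..<int p}. int p dvd poly g t})"
      by (rule card_mono[rotated]) (simp only: finite_insert finite_residues)
    also have "\<dots> \<le> Suc n"
      using IH by (simp add: card_insert_if finite_residues del: mem_Collect_eq atLeastLessThan_iff)
    finally show ?thesis .
  next
    case False
    then have no_root: "{t \<in> {0..<int p}. int p dvd poly f t} = {}" by blast
    show ?thesis unfolding no_root by simp
  qed
qed

definition diag2 :: "'a::comm_ring_1 \<Rightarrow> 'a \<Rightarrow> 'a^2^2" where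
  "diag2 a b = vector [vector [a, 0], vector [0, b]]"

lemma diag2_nth [simp]: "diag2 a b $ 1 $ 1 = a" "diag2 a b $ 1 $ 2 = 0"
  "diag2 a b $ 2 $ 1 = 0" "diag2 a b $ 2 $ 2 = b"
  by (simp_all add: diag2_def)

definition curve_mat :: "'a::comm_ring_1 \<Rightarrow> 'a \<Rightarrow> 'a \<Rightarrow> 'a \<Rightarrow> 'a^2^2" where
  "curve_mat q d t t' = vector [vector [t, q], vector [1, d * t']]"

lemma curve_mat_nth [simp]: "curve_mat q d t t' $ 1 $ 1 = t" "curve_mat q d t t' $ 1 $ 2 = q"
  "curve_mat q d t t' $ 2 $ 1 = 1" "curve_mat q d t t' $ 2 $ 2 = d * t'"
  by (simp_all add: curve_mat_def)

text \<open>This is $t$ times the matrix \<open>curve_mat q d t (1 / t)\<close>, with $t$ an indeterminate.\<close>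

definition curve_poly_mat :: "int \<Rightarrow> int \<Rightarrow> int poly^2^2" where
  "curve_poly_mat q d = vector [vector [[:0, 0, 1:], [:0, q:]], vector [[:0, 1:], [:d:]]]"

lemma curve_poly_mat_nth [simp]: "curve_poly_mat q d $ 1 $ 1 = [:0, 0, 1:]"
  "curve_poly_mat q d $ 1 $ 2 = [:0, q:]"
  "curve_poly_mat q d $ 2 $ 1 = [:0, 1:]" "curve_poly_mat q d $ 2 $ 2 = [:d:]"
  by (simp_all add: curve_poly_mat_def)

definition curve_word :: "int \<Rightarrow> int \<Rightarrow> int \<Rightarrow> int \<Rightarrow> letter list \<Rightarrow> int poly^2^2" where
  "curve_word a a' q d w = word_mat (diag2 [:a:] [:a':]) (curve_poly_mat q d) w"

lemma letter_neq_GY_True_cases: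
  assumes "l \<noteq> (GY, True)"
  obtains "l = (GX, False)" | "l = (GX, True)" | "l = (GY, False)"
  using assms by (cases l; cases "fst l"; cases "snd l") auto

text \<open>Each letter Y contributes one factor t, which clears the denominator of its lower right
  entry: modulo \<open>m\<close>, the constant \<open>d\<close> is t times
  \<open>d * t'\<close>.\<close>

lemma poly_curve_word:
  assumes "(GY, True) \<notin> set w" "[t * t' = 1] (mod m)"
  shows "[poly (curve_word a a' q d w $ i $ j) t =
    t ^ count_Y w * word_mat (diag2 a a') (curve_mat q d t t') w $ i $ j] (mod m)"
  using assms(1)
proof (induction w arbitrary: i j)
  case Nil
  show ?case
    using exhaust_2[of i] exhaust_2[of j] by (auto simp: curve_word_def count_Y_def)
next
  case (Cons l w)
  let ?P = "curve_word a a' q d w" and ?W = "word_mat (diag2 a a') (curve_mat q d t t') w"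
  let ?L = "letter_mat (diag2 [:a:] [:a':]) (curve_poly_mat q d) l"
  let ?M = "letter_mat (diag2 a a') (curve_mat q d t t') l"
  let ?k = "count_Y [l]"
  have IH: "[poly (?P $ i $ j) t = t ^ count_Y w * ?W $ i $ j] (mod m)" for i j
    using Cons by simp
  have letter: "[poly (?L $ i $ h) t = t ^ ?k * ?M $ i $ h] (mod m)" for h
  proof -
    have td: "[d = t * (d * t')] (mod m)"
      using cong_scalar_left[OF assms(2), of d] by (simp add: cong_sym mult.left_commute)
    have "l \<noteq> (GY, True)" using Cons.prems by auto
    then show ?thesis
      by (rule letter_neq_GY_True_cases; use exhaust_2[of i] exhaust_2[of h] td in
          \<open>auto simp: letter_mat_def count_Y_def\<close>)
  qed
  have "poly (curve_word a a' q d (l # w) $ i $ j) t =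
      poly (?L $ i $ 1) t * poly (?P $ 1 $ j) t + poly (?L $ i $ 2) t * poly (?P $ 2 $ j) t"
    by (simp add: curve_word_def matrix2_mult_nth)
  moreover have "[\<dots> = (t ^ ?k * ?M $ i $ 1) * (t ^ count_Y w * ?W $ 1 $ j) +
      (t ^ ?k * ?M $ i $ 2) * (t ^ count_Y w * ?W $ 2 $ j)] (mod m)"
    by (intro cong_add cong_mult letter IH)
  moreover have "(t ^ ?k * ?M $ i $ 1) * (t ^ count_Y w * ?W $ 1 $ j) +
      (t ^ ?k * ?M $ i $ 2) * (t ^ count_Y w * ?W $ 2 $ j) =
      t ^ count_Y (l # w) * word_mat (diag2 a a') (curve_mat q d t t') (l # w) $ i $ j"
    by (simp add: matrix2_mult_nth count_Y_def power_add algebra_simps)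
  ultimately show ?case by simp
qed

text \<open>Only the upper left entry of the letter Y has degree 2, so that entry of the product
  dominates; the other bounds keep the induction going. The lower left entry is bounded through
  coefficients because it is the zero polynomial when no Y occurs. The last clause requires a letter
  Y: otherwise the lower right entry is a nonzero constant, in degree
  \<open>2 * count_Y w\<close>.\<close>

lemma curve_word_degree:
  assumes "(GY, True) \<notin> set w" and p: "prime p" and a: "[a * a' = 1] (mod int p)"
  shows "degree (curve_word a a' q d w $ 1 $ 1) \<le> 2 * count_Y w \<and>
    \<not> int p dvd coeff (curve_word a a' q d w $ 1 $ 1) (2 * count_Y w) \<and>
    degree (curve_word a a' q d w $ 1 $ 2) \<le> 2 * count_Y w \<and>
    degree (curve_word a a' q d w $ 2 $ 2) \<le> 2 * count_Y w \<and>
    (\<forall>i\<ge>2 * count_Y w. coeff (curve_word a a' q d w $ 2 $ 1) i = 0) \<and>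
    (count_Y w > 0 \<longrightarrow> coeff (curve_word a a' q d w $ 2 $ 2) (2 * count_Y w) = 0)"
  using assms(1)
proof (induction w)
  case Nil
  have "\<not> int p dvd 1" using p by (auto simp: prime_nat_iff)
  then show ?case by (simp add: curve_word_def count_Y_def)
next
  case (Cons l w)
  let ?P = "curve_word a a' q d w" and ?n = "2 * count_Y w"
  have unit: "\<not> int p dvd a" "\<not> int p dvd a'"
  proof -
    have "\<not> int p dvd a * a'"
      using a p by (metis cong_dvd_iff dvd_refl int_dvd_int_iff not_prime_1 of_nat_1 nat_dvd_1_iff_1)
    then show "\<not> int p dvd a" "\<not> int p dvd a'" by auto
  qed
  have pr: "prime (int p)" using p by simp
  have IH: "\<And>i. ?n < i \<Longrightarrow> coeff (?P $ 1 $ 1) i = 0" "\<not> int p dvd coeff (?P $ 1 $ 1) ?n"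
    "\<And>i. ?n < i \<Longrightarrow> coeff (?P $ 1 $ 2) i = 0" "\<And>i. ?n < i \<Longrightarrow> coeff (?P $ 2 $ 2) i = 0"
    "\<And>i. ?n \<le> i \<Longrightarrow> coeff (?P $ 2 $ 1) i = 0"
    "count_Y w > 0 \<Longrightarrow> coeff (?P $ 2 $ 2) ?n = 0"
    using Cons by (auto simp: coeff_eq_0)
  have "l \<noteq> (GY, True)" using Cons.prems by auto
  then show ?case
  proof (cases rule: letter_neq_GY_True_cases)
    case 1
    then have c: "count_Y (l # w) = count_Y w" by (simp add: count_Y_def)
    have P: "curve_word a a' q d (l # w) $ 1 $ j = smult a (?P $ 1 $ j)"
      "curve_word a a' q d (l # w) $ 2 $ j = smult a' (?P $ 2 $ j)" for j
      using 1 by (simp_all add: curve_word_def letter_mat_def matrix2_mult_nth)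
    show ?thesis
      unfolding c P using IH unit pr by (auto intro!: degree_le simp: prime_dvd_mult_iff)
  next
    case 2
    then have c: "count_Y (l # w) = count_Y w" by (simp add: count_Y_def)
    have P: "curve_word a a' q d (l # w) $ 1 $ j = smult a' (?P $ 1 $ j)"
      "curve_word a a' q d (l # w) $ 2 $ j = smult a (?P $ 2 $ j)" for j
      using 2 by (simp_all add: curve_word_def letter_mat_def matrix2_mult_nth)
    show ?thesis
      unfolding c P using IH unit pr by (auto intro!: degree_le simp: prime_dvd_mult_iff)
  next
    case 3
    then have c: "2 * count_Y (l # w) = Suc (Suc ?n)" "count_Y (l # w) > 0" by (simp_all add: count_Y_def)
    have P: "curve_word a a' q d (l # w) $ 1 $ j = pCons 0 (pCons 0 (?P $ 1 $ j)) + smult q (pCons 0 (?P $ 2 $ j))"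
      "curve_word a a' q d (l # w) $ 2 $ j = pCons 0 (?P $ 1 $ j) + smult d (?P $ 2 $ j)" for j
      using 3 by (simp_all add: curve_word_def letter_mat_def matrix2_mult_nth)
    have shift: "i > Suc (Suc n) \<Longrightarrow> \<exists>k. i = Suc (Suc k) \<and> k > n" for i n :: nat
      by (cases i; cases "i - 1") auto
    show ?thesis
      unfolding c P
    proof (intro conjI allI impI degree_le)
      show "coeff (pCons 0 (pCons 0 (?P $ 1 $ 1)) + smult q (pCons 0 (?P $ 2 $ 1))) i = 0"
        if "Suc (Suc ?n) < i" for i
        using shift[OF that] IH by auto
      show "\<not> int p dvd coeff (pCons 0 (pCons 0 (?P $ 1 $ 1)) + smult q (pCons 0 (?P $ 2 $ 1))) (Suc (Suc ?n))"
        using IH by simp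
      show "coeff (pCons 0 (pCons 0 (?P $ 1 $ 2)) + smult q (pCons 0 (?P $ 2 $ 2))) i = 0"
        if "Suc (Suc ?n) < i" for i
        using shift[OF that] IH by auto
      show "coeff (pCons 0 (?P $ 1 $ 2) + smult d (?P $ 2 $ 2)) i = 0"
        if "Suc (Suc ?n) < i" for i
        using shift[OF that] IH by auto
      show "coeff (pCons 0 (?P $ 1 $ 1) + smult d (?P $ 2 $ 1)) i = 0"
        if "Suc (Suc ?n) \<le> i" for i
        using that IH by (cases i) auto
      show "coeff (pCons 0 (?P $ 1 $ 2) + smult d (?P $ 2 $ 2)) (Suc (Suc ?n)) = 0"
        using IH by simp
    qed
  qed
qed

text \<open>Multiplication by t^N, N being the number of letters Y, turns the condition into a root
  of a polynomial of degree 2 N. The subtracted monomial of degree N lies strictly below the top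
  since N > 0.\<close>

lemma card_curve_fixed_le:
  assumes w: "(GY, True) \<notin> set w" "count_Y w > 0" and p: "prime p"
    and a: "[a * a' = 1] (mod int p)" and d: "[d = 1 + q] (mod int p)"
    and T: "\<And>t. t \<in> {1..<int p} \<Longrightarrow> [t * T t = 1] (mod int p)"
  shows "card {t \<in> {1..<int p}. [eval3 (trace_poly w) (a + a') (t + d * T t) (a * t + a' * (d * T t)) =
      a + a'] (mod int p)} \<le> 2 * count_Y w"
proof -
  define n where "n = count_Y w"
  define f where "f = curve_word a a' q d w $ 1 $ 1 + curve_word a a' q d w $ 2 $ 2 - monom (a + a') n"
  note deg = curve_word_degree[OF w(1) p a, of q d, folded n_def]
  have "degree (monom (a + a') n) \<le> 2 * n"
    using degree_monom_le[of "a + a'" n] by simp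
  then have "degree f \<le> 2 * n"
    unfolding f_def using deg by (intro degree_diff_le degree_add_le) auto
  moreover have "\<not> int p dvd coeff f (2 * n)"
    using deg w(2) by (simp add: f_def n_def)
  ultimately have card: "card {t \<in> {0..<int p}. int p dvd poly f t} \<le> 2 * n"
    using card_roots_mod_prime_le[OF p] by blast
  have "int p dvd poly f t"
    if t: "t \<in> {1..<int p}" and fixed: "[eval3 (trace_poly w) (a + a') (t + d * T t) (a * t + a' * (d * T t)) =
      a + a'] (mod int p)" for t
  proof -
    let ?A = "diag2 a a'" and ?B = "curve_mat q d t (T t)"
    have "int p dvd det ?A - 1"
      using a by (simp add: det_2 cong_iff_dvd_diff)
    moreover have "int p dvd det ?B - 1"
    proof -
      have "[d * (t * T t) - q = (1 + q) * 1 - q] (mod int p)"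
        by (intro cong_diff cong_mult d T[OF t] cong_refl)
      then show ?thesis by (simp add: det_2 cong_iff_dvd_diff mult.left_commute)
    qed
    ultimately have "int p dvd trace (word_mat ?A ?B w) -
        eval3 (fricke_trace w) (trace ?A) (trace ?B) (trace (?A ** ?B))"
      by (rule trace_fricke_dvd)
    then have "[trace (word_mat ?A ?B w) =
        eval3 (trace_poly w) (a + a') (t + d * T t) (a * t + a' * (d * T t))] (mod int p)"
      by (simp add: cong_iff_dvd_diff trace_poly_eq_fricke_trace trace2 matrix2_mult_nth)
    then have tr: "[trace (word_mat ?A ?B w) = a + a'] (mod int p)"
      using fixed by (rule cong_trans)
    have "[poly (curve_word a a' q d w $ 1 $ 1) t + poly (curve_word a a' q d w $ 2 $ 2) t =
        t ^ n * word_mat ?A ?B w $ 1 $ 1 + t ^ n * word_mat ?A ?B w $ 2 $ 2] (mod int p)"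
      unfolding n_def by (intro cong_add poly_curve_word[OF w(1) T[OF t]])
    also have "t ^ n * word_mat ?A ?B w $ 1 $ 1 + t ^ n * word_mat ?A ?B w $ 2 $ 2 =
        t ^ n * trace (word_mat ?A ?B w)" by (simp add: trace2 algebra_simps)
    also have "[\<dots> = t ^ n * (a + a')] (mod int p)"
      by (intro cong_mult tr cong_refl)
    finally show ?thesis
      by (simp add: f_def cong_iff_dvd_diff poly_monom mult.commute)
  qed
  then have "{t \<in> {1..<int p}. [eval3 (trace_poly w) (a + a') (t + d * T t) (a * t + a' * (d * T t)) =
      a + a'] (mod int p)} \<subseteq> {t \<in> {0..<int p}. int p dvd poly f t}" by auto
  then have "card {t \<in> {1..<int p}. [eval3 (trace_poly w) (a + a') (t + d * T t) (a * t + a' * (d * T t)) =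
      a + a'] (mod int p)} \<le> card {t \<in> {0..<int p}. int p dvd poly f t}"
    by (rule card_mono[rotated]) (rule finite_residues)
  with card show ?thesis by (simp add: n_def)
qed

lemma curve_on_surface:
  assumes "[a * a' = 1] (mod m)" "[d = 1 + q] (mod m)" "[t * t' = 1] (mod m)"
    "[(a - a')\<^sup>2 * q = 2 - \<kappa>] (mod (m::int))"
    and "x = a + a'" "y = t + d * t'" "z = a * t + a' * (d * t')"
  shows "[x\<^sup>2 + y\<^sup>2 + z\<^sup>2 = x * y * z + 2 + \<kappa>] (mod m)"
proof -
  obtain i j k l where e: "a * a' - 1 = m * i" "d - (1 + q) = m * j" "t * t' - 1 = m * k"
    "(a - a')\<^sup>2 * q - (2 - \<kappa>) = m * l"
    using assms(1-4) unfolding cong_iff_dvd_diff dvd_def by auto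
  \<comment> \<open>The difference of the two sides lies in the ideal generated by the four defects,
    each a multiple of \<open>m\<close>.\<close>
  have "\<exists>r. x\<^sup>2 + y\<^sup>2 + z\<^sup>2 - (x * y * z + 2 + \<kappa>) = m * r"
    unfolding assms(5-7) using e by algebra
  then show ?thesis
    unfolding cong_iff_dvd_diff dvd_def by blast
qed

section \<open>The action of automorphisms\<close>

abbreviation X2 :: f2 where "X2 \<equiv> f2_letter (GX, False)"

abbreviation Y2 :: f2 where "Y2 \<equiv> f2_letter (GY, False)"

definition additive_map :: "('a::group_add \<Rightarrow> 'a) \<Rightarrow> bool" where
  "additive_map T \<longleftrightarrow> (\<forall>x y. T (x + y) = T x + T y)"

lemma additive_map_add: "additive_map T \<Longrightarrow> T (x + y) = T x + T y"
  by (simp add: additive_map_def)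

lemma additive_map_0: "additive_map T \<Longrightarrow> T 0 = 0"
  using additive_map_add[of T 0 0] add_left_cancel[of "T 0" "T 0" 0] by simp

lemma additive_map_uminus: "additive_map T \<Longrightarrow> T (- x) = - T x"
  using additive_map_add[of T x "- x"] minus_unique[of "T x" "T (- x)"] by (simp add: additive_map_0)

lemma additive_map_funpow: "additive_map T \<Longrightarrow> additive_map (T ^^ n)"
  by (induction n) (simp_all add: additive_map_def)

lemma additive_map_inv:
  assumes "additive_map T" "bij T"
  shows "additive_map (inv_into UNIV T)"
  unfolding additive_map_def
proof (intro allI)
  fix x y
  have "T (inv_into UNIV T x + inv_into UNIV T y) = x + y"
    using assms by (simp add: additive_map_add bij_is_surj surj_f_inv_f)
  then show "inv_into UNIV T (x + y) = inv_into UNIV T x + inv_into UNIV T y"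
    using assms(2) by (metis bij_inv_eq_iff)
qed

lemma generates_image:
  assumes "additive_map T" "surj T" "generates u v"
  shows "generates (T u) (T v)"
  unfolding generates_def
proof (intro allI impI)
  fix S assume S: "subgroup_closed S" "T u \<in> S" "T v \<in> S"
  have "subgroup_closed (T -` S)"
    using S(1) by (simp add: subgroup_closed_def additive_map_add[OF assms(1)] additive_map_uminus[OF assms(1)])
  then have "T -` S = UNIV"
    using assms(3) S by (simp add: generates_def)
  then show "S = UNIV"
    using assms(2) by (metis surj_image_vimage_eq)
qed

lemma trace_word_mat:
  fixes A B :: "complex^2^2"
  assumes "det A = 1" "det B = 1"
  shows "trace (word_mat A B w) = eval3 (trace_poly w) (trace A) (trace B) (trace (A ** B))"
  using trace_word_eval_fricke[OF assms]
  by (simp add: word_eval_eq_word_mat[OF assms] trace_poly_eq_fricke_trace)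

lemma trace_poly_letter: "trace_poly (Rep_f2 X2) = var_x" "trace_poly (Rep_f2 Y2) = var_y"
  "trace_poly (Rep_f2 (X2 + Y2)) = var_z"
  by (rule trace_poly_eqI; simp add: word_eval_eq_word_mat word_mat_f2_add f2_letter.rep_eq letter_mat_def)+

lemma word_mat_additive_map:
  assumes det: "det A = 1" "det B = 1" and T: "additive_map T"
  shows "word_mat (word_mat A B (Rep_f2 (T X2))) (word_mat A B (Rep_f2 (T Y2))) w =
    word_mat A B (Rep_f2 (T (sum_list (map f2_letter w))))"
proof (induction w)
  case Nil
  show ?case by (simp add: additive_map_0[OF T] zero_f2.rep_eq)
next
  case (Cons a w)
  have "letter_mat (word_mat A B (Rep_f2 (T X2))) (word_mat A B (Rep_f2 (T Y2))) a =
      word_mat A B (Rep_f2 (T (f2_letter a)))"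
    by (cases a; cases "fst a"; cases "snd a")
      (simp_all add: letter_mat_def f2_letter_GX_GY additive_map_uminus[OF T] word_mat_f2_uminus[OF det])
  with Cons show ?case
    by (simp add: additive_map_add[OF T] word_mat_f2_add[OF det])
qed

text \<open>Realize the integer triple as traces of complex matrices \<open>A\<close>,
  \<open>B\<close>. The image of a word, evaluated at \<open>(A, B)\<close>, is the word evaluated
  at the matrices of \<open>T X2\<close> and \<open>T Y2\<close>; injectivity of
  \<open>of_int\<close> brings the identity back to the integers.\<close>

lemma trace_poly_additive_map:
  fixes x y z :: int
  assumes T: "additive_map T"
  shows "eval3 (trace_poly (Rep_f2 (T g))) x y z =
    eval3 (trace_poly (Rep_f2 g)) (eval3 (trace_poly (Rep_f2 (T X2))) x y z)
      (eval3 (trace_poly (Rep_f2 (T Y2))) x y z) (eval3 (trace_poly (Rep_f2 (T (X2 + Y2)))) x y z)"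
proof -
  obtain A B :: "complex^2^2" where det: "det A = 1" "det B = 1"
    and tr: "trace A = of_int x" "trace B = of_int y" "trace (A ** B) = of_int z"
    by (rule exists_SL2_traces)
  have ev: "trace (word_mat A B (Rep_f2 h)) = of_int (eval3 (trace_poly (Rep_f2 h)) x y z)" for h
    by (simp add: trace_word_mat[OF det] tr eval3_of_int)
  let ?A = "word_mat A B (Rep_f2 (T X2))" and ?B = "word_mat A B (Rep_f2 (T Y2))"
  have "trace (word_mat A B (Rep_f2 (T g))) = trace (word_mat ?A ?B (Rep_f2 g))"
    by (simp add: word_mat_additive_map[OF det T] sum_list_f2_letter)
  also have "\<dots> = eval3 (trace_poly (Rep_f2 g)) (trace ?A) (trace ?B) (trace (?A ** ?B))"
    by (intro trace_word_mat det_word_mat det)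
  also have "?A ** ?B = word_mat A B (Rep_f2 (T (X2 + Y2)))"
    by (simp add: additive_map_add[OF T] word_mat_f2_add[OF det])
  finally show ?thesis
    unfolding ev eval3_of_int of_int_eq_iff .
qed

text \<open>An ambient set common to all \<kappa>, on which finiteness and injectivity of the action
  are established.\<close>

definition residue_triples :: "nat \<Rightarrow> (int \<times> int \<times> int) set" where
  "residue_triples p = {0..<int p} \<times> {0..<int p} \<times> {0..<int p}"

definition f2_act :: "nat \<Rightarrow> (f2 \<Rightarrow> f2) \<Rightarrow> int \<times> int \<times> int \<Rightarrow> int \<times> int \<times> int" where
  "f2_act p T = (\<lambda>(x, y, z).
     (eval3 (trace_poly (Rep_f2 (T X2))) x y z mod int p,
      eval3 (trace_poly (Rep_f2 (T Y2))) x y z mod int p,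
      eval3 (trace_poly (Rep_f2 (T (X2 + Y2)))) x y z mod int p))"

text \<open>Substitution into polynomials is contravariant, hence the order of composition; powers
  of a single map are unaffected.\<close>

lemma f2_act_comp:
  assumes "additive_map S" "additive_map T"
  shows "f2_act p S (f2_act p T v) = f2_act p (T \<circ> S) v"
proof -
  obtain x y z where v: "v = (x, y, z)" by (cases v)
  have "eval3 (trace_poly (Rep_f2 g)) (eval3 (trace_poly (Rep_f2 (T X2))) x y z mod int p)
      (eval3 (trace_poly (Rep_f2 (T Y2))) x y z mod int p)
      (eval3 (trace_poly (Rep_f2 (T (X2 + Y2)))) x y z mod int p) mod int p =
      eval3 (trace_poly (Rep_f2 (T g))) x y z mod int p" for g
    unfolding trace_poly_additive_map[OF assms(2), of g]
    by (rule eval3_cong_mod[unfolded cong_def]) simp_all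
  then show ?thesis
    by (simp add: v f2_act_def)
qed

lemma f2_act_id: "v \<in> residue_triples p \<Longrightarrow> f2_act p (\<lambda>x. x) v = v"
  by (auto simp: f2_act_def residue_triples_def trace_poly_letter)

lemma f2_act_residue_triples: "p > 0 \<Longrightarrow> f2_act p T v \<in> residue_triples p"
  by (auto simp: f2_act_def residue_triples_def split: prod.splits)

lemma f2_act_funpow:
  assumes "additive_map T" "v \<in> residue_triples p"
  shows "(f2_act p T ^^ n) v = f2_act p (T ^^ n) v"
proof (induction n)
  case 0
  show ?case using f2_act_id[OF assms(2)] by (simp add: id_def)
next
  case (Suc n)
  have "(f2_act p T ^^ Suc n) v = f2_act p T (f2_act p (T ^^ n) v)"
    using Suc by simp
  also have "\<dots> = f2_act p (T ^^ n \<circ> T) v"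
    by (rule f2_act_comp[OF assms(1) additive_map_funpow[OF assms(1)]])
  also have "T ^^ n \<circ> T = T ^^ Suc n"
    by (rule funpow_Suc_right[symmetric])
  finally show ?case .
qed

lemma inj_on_f2_act:
  assumes "additive_map T" "bij T"
  shows "inj_on (f2_act p T) (residue_triples p)"
proof (rule inj_on_inverseI[of _ "f2_act p (inv_into UNIV T)"])
  fix v assume "v \<in> residue_triples p"
  then show "f2_act p (inv_into UNIV T) (f2_act p T v) = v"
    using f2_act_id[of v p] assms(2)
    by (simp add: f2_act_comp[OF additive_map_inv[OF assms] assms(1)] comp_def bij_is_surj surj_f_inv_f)
qed

text \<open>\<open>orbit f v\<close> consists of the iterates from the first one on. One iterate
  more than the orbit has elements forces a coincidence, and injectivity shifts it back to
  \<open>v\<close> itself.\<close>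

lemma funpow_returns_within_orbit:
  assumes "finite S" "f ` S \<subseteq> S" "inj_on f S" "v \<in> S"
  obtains n where "0 < n" "n \<le> card (orbit f v)" "(f ^^ n) v = v"
proof -
  have mem: "(f ^^ n) v \<in> S" for n
    by (induction n) (use assms in auto)
  have orbit: "orbit f v \<subseteq> S"
    using mem by (auto simp: orbit_altdef)
  have fin: "finite (orbit f v)"
    using orbit assms(1) finite_subset by blast
  let ?N = "card (orbit f v)"
  have "(\<lambda>n. (f ^^ n) v) ` {1..Suc ?N} \<subseteq> orbit f v"
    by (auto simp: orbit_altdef)
  then have "card ((\<lambda>n. (f ^^ n) v) ` {1..Suc ?N}) < card {1..Suc ?N}"
    using card_mono[OF fin] by (simp add: le_imp_less_Suc)
  then have "\<not> inj_on (\<lambda>n. (f ^^ n) v) {1..Suc ?N}"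
    using card_image by fastforce
  then obtain i j where ij: "i \<in> {1..Suc ?N}" "j \<in> {1..Suc ?N}" "i < j" "(f ^^ i) v = (f ^^ j) v"
    unfolding inj_on_def by (metis linorder_neqE_nat)
  have "(f ^^ i) v = (f ^^ (i + k)) v \<Longrightarrow> v = (f ^^ k) v" for k
  proof (induction i)
    case (Suc i)
    then have "f ((f ^^ i) v) = f ((f ^^ (i + k)) v)" by simp
    then have "(f ^^ i) v = (f ^^ (i + k)) v"
      using assms(3) mem by (meson inj_onD)
    then show ?case by (rule Suc.IH)
  qed simp
  from this[of "j - i"] have "(f ^^ (j - i)) v = v" using ij by simp
  moreover have "0 < j - i" "j - i \<le> ?N" using ij by auto
  ultimately show thesis using that by blast
qed

lemma exp_sum_additive_map:
  assumes T: "additive_map T"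
  shows "exp_sum s (Rep_f2 (T g)) =
    exp_sum GX (Rep_f2 g) * exp_sum s (Rep_f2 (T X2)) + exp_sum GY (Rep_f2 g) * exp_sum s (Rep_f2 (T Y2))"
proof -
  have "exp_sum s (Rep_f2 (T (sum_list (map f2_letter w)))) =
    exp_sum GX w * exp_sum s (Rep_f2 (T X2)) + exp_sum GY w * exp_sum s (Rep_f2 (T Y2))" for w
  proof (induction w)
    case Nil
    show ?case by (simp add: additive_map_0[OF T] exp_sum_f2_0) (simp add: exp_sum_def)
  next
    case (Cons a w)
    have cons: "exp_sum s' (a # w) = letter_exp s' a + exp_sum s' w" for s'
      by (simp add: exp_sum_eq_sum_list)
    have "exp_sum s (Rep_f2 (T (f2_letter a))) =
      letter_exp GX a * exp_sum s (Rep_f2 (T X2)) + letter_exp GY a * exp_sum s (Rep_f2 (T Y2))"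
      by (cases a; cases "fst a"; cases "snd a")
        (simp_all add: letter_exp_def f2_letter_GX_GY additive_map_uminus[OF T] exp_sum_f2_uminus)
    then show ?case
      by (simp add: additive_map_add[OF T] exp_sum_f2_add Cons cons algebra_simps)
  qed
  from this[of "Rep_f2 g"] show ?thesis
    by (simp add: sum_list_f2_letter)
qed

lemma exp_sum_f2_letter: "exp_sum GX (Rep_f2 X2) = 1" "exp_sum GY (Rep_f2 X2) = 0"
  "exp_sum GX (Rep_f2 Y2) = 0" "exp_sum GY (Rep_f2 Y2) = 1"
  by (simp_all add: f2_letter.rep_eq exp_sum_def)

section \<open>From automorphisms of \<open>F2\<close> and outer classes to maps of the type
  \<open>f2\<close>\<close>

definition f2_map :: "(letter list \<Rightarrow> letter list) \<Rightarrow> f2 \<Rightarrow> f2" where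
  "f2_map \<theta> x = Abs_f2 (\<theta> (Rep_f2 x))"

lemma Rep_f2_carrier: "Rep_f2 x \<in> carrier F2"
  using Rep_f2[of x] by (simp add: F2_def)

lemma Rep_Abs_f2: "w \<in> carrier F2 \<Longrightarrow> Rep_f2 (Abs_f2 w) = w"
  by (simp add: F2_def Abs_f2_inverse)

lemma mult_F2: "Rep_f2 x \<otimes>\<^bsub>F2\<^esub> Rep_f2 y = Rep_f2 (x + y)"
  by (simp add: F2_def plus_f2.rep_eq)

lemma inv_F2: "inv\<^bsub>F2\<^esub> (Rep_f2 x) = Rep_f2 (- x)"
  by (rule group.inv_equality[OF group_F2])
    (simp_all add: Rep_f2_carrier mult_F2, simp add: F2_def zero_f2.rep_eq)

lemma auto_F2_f2_map:
  assumes "\<theta> \<in> auto F2"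
  shows Rep_f2_map: "Rep_f2 (f2_map \<theta> x) = \<theta> (Rep_f2 x)"
    and additive_f2_map: "additive_map (f2_map \<theta>)"
    and bij_f2_map: "bij (f2_map \<theta>)"
proof -
  have hom: "\<theta> \<in> hom F2 F2" and bij: "bij_betw \<theta> (carrier F2) (carrier F2)"
    using assms by (auto simp: auto_def Bij_def)
  show Rep: "Rep_f2 (f2_map \<theta> x) = \<theta> (Rep_f2 x)" for x
    unfolding f2_map_def using bij Rep_f2_carrier by (intro Rep_Abs_f2) (meson bij_betwE)
  show "additive_map (f2_map \<theta>)"
    unfolding additive_map_def
  proof (intro allI)
    fix x y
    have "Rep_f2 (f2_map \<theta> (x + y)) = Rep_f2 (f2_map \<theta> x + f2_map \<theta> y)"
      using hom_mult[OF hom Rep_f2_carrier Rep_f2_carrier, of x y]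
      by (simp only: Rep mult_F2[symmetric])
    then show "f2_map \<theta> (x + y) = f2_map \<theta> x + f2_map \<theta> y"
      by (simp add: Rep_f2_inject)
  qed
  show "bij (f2_map \<theta>)"
  proof (rule bijI)
    show "inj (f2_map \<theta>)"
    proof (rule injI)
      fix x y assume "f2_map \<theta> x = f2_map \<theta> y"
      then have "\<theta> (Rep_f2 x) = \<theta> (Rep_f2 y)" by (metis Rep)
      then have "Rep_f2 x = Rep_f2 y"
        using bij Rep_f2_carrier by (meson bij_betw_def inj_onD)
      then show "x = y" by (simp add: Rep_f2_inject)
    qed
    show "surj (f2_map \<theta>)"
    proof (rule surjI)
      fix y
      have "Rep_f2 y \<in> \<theta> ` carrier F2"
        using bij Rep_f2_carrier by (simp add: bij_betw_def)
      then have *: "inv_into (carrier F2) \<theta> (Rep_f2 y) \<in> carrier F2"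
        "\<theta> (inv_into (carrier F2) \<theta> (Rep_f2 y)) = Rep_f2 y"
        by (simp_all add: inv_into_into f_inv_into_f)
      show "f2_map \<theta> (Abs_f2 (inv_into (carrier F2) \<theta> (Rep_f2 y))) = y"
        unfolding f2_map_def by (simp add: Rep_Abs_f2 * Rep_f2_inverse)
    qed
  qed
qed

lemma gen_eq_Rep_f2: "genX = Rep_f2 X2" "genY = Rep_f2 Y2"
  by (simp_all add: genX_def genY_def f2_letter.rep_eq)

lemma aut_act_eq_f2_act:
  assumes "\<theta> \<in> auto F2"
  shows "aut_act p \<theta> = f2_act p (f2_map \<theta>)"
  unfolding aut_act_def f2_act_def gen_eq_Rep_f2
  by (simp add: mult_F2 additive_map_add[OF additive_f2_map[OF assms]] flip: Rep_f2_map[OF assms])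

text \<open>Members of the coset differ from a representative by a conjugation, which leaves traces
  and exponent sums unchanged.\<close>

lemma Out_cosetE:
  assumes "g \<in> carrier (Out F2)"
  obtains \<theta> where "\<theta> \<in> auto F2" "g \<noteq> {}"
    "\<And>\<phi>. \<phi> \<in> g \<Longrightarrow> \<exists>c. \<forall>x. \<phi> (Rep_f2 x) = Rep_f2 (c + f2_map \<theta> x - c)"
proof -
  obtain \<theta> where \<theta>: "\<theta> \<in> auto F2" and g: "g = Inn F2 #>\<^bsub>AutoGroup F2\<^esub> \<theta>"
    using assms by (auto simp: Out_def FactGroup_def RCOSETS_def AutoGroup_def)
  have "Inn F2 \<noteq> {}"
    using Rep_f2_carrier[of 0] by (auto simp: Inn_def)
  then have "g \<noteq> {}" by (auto simp: g r_coset_def)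
  moreover have "\<exists>c. \<forall>x. \<phi> (Rep_f2 x) = Rep_f2 (c + f2_map \<theta> x - c)" if \<phi>_g: "\<phi> \<in> g" for \<phi>
  proof -
    obtain a where a: "a \<in> carrier F2" and
      \<phi>: "\<phi> = (\<lambda>x\<in>carrier F2. a \<otimes>\<^bsub>F2\<^esub> x \<otimes>\<^bsub>F2\<^esub> inv\<^bsub>F2\<^esub> a) \<otimes>\<^bsub>AutoGroup F2\<^esub> \<theta>"
      using \<phi>_g unfolding g r_coset_def Inn_def by blast
    define c where "c = Abs_f2 a"
    have ac: "a = Rep_f2 c" using a by (simp add: c_def Rep_Abs_f2)
    let ?h = "\<lambda>x\<in>carrier F2. a \<otimes>\<^bsub>F2\<^esub> x \<otimes>\<^bsub>F2\<^esub> inv\<^bsub>F2\<^esub> a"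
    have h: "?h (Rep_f2 x) = Rep_f2 (c + x - c)" for x
      by (simp add: Rep_f2_carrier ac inv_F2 mult_F2)
    \<comment> \<open>The product of \<open>AutoGroup\<close> unfolds to a composition only for
      arguments known to lie in \<open>Bij\<close>.\<close>
    have "bij_betw ?h (carrier F2) (carrier F2)"
    proof (rule bij_betw_byWitness[where f' = "\<lambda>w. Rep_f2 (- c + Abs_f2 w + c)"])
      show "\<forall>w\<in>carrier F2. Rep_f2 (- c + Abs_f2 (?h w) + c) = w"
      proof
        fix w assume w: "w \<in> carrier F2"
        then have "?h w = Rep_f2 (c + Abs_f2 w - c)"
          using h[of "Abs_f2 w"] by (simp only: Rep_Abs_f2)
        then show "Rep_f2 (- c + Abs_f2 (?h w) + c) = w"
          using w by (simp only: Rep_f2_inverse)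
            (simp add: Rep_Abs_f2 group_add_normalize del: add_uminus_conv_diff)
      qed
      show "\<forall>w\<in>carrier F2. ?h (Rep_f2 (- c + Abs_f2 w + c)) = w"
        unfolding h by (simp add: Rep_Abs_f2 group_add_normalize del: add_uminus_conv_diff)
      show "?h ` carrier F2 \<subseteq> carrier F2"
        using h by (metis (no_types, lifting) Rep_Abs_f2 Rep_f2_carrier image_subsetI)
      show "(\<lambda>w. Rep_f2 (- c + Abs_f2 w + c)) ` carrier F2 \<subseteq> carrier F2"
        using Rep_f2_carrier by blast
    qed
    then have "?h \<in> Bij (carrier F2)"
      by (simp add: Bij_def)
    moreover have "\<theta> \<in> Bij (carrier F2)" using \<theta> by (simp add: auto_def)
    ultimately have "\<phi> = compose (carrier F2) ?h \<theta>"
      unfolding \<phi> by (simp add: AutoGroup_def BijGroup_def)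
    then have "\<phi> (Rep_f2 x) = ?h (\<theta> (Rep_f2 x))" for x
      by (simp only: compose_eq Rep_f2_carrier)
    then have "\<phi> (Rep_f2 x) = Rep_f2 (c + f2_map \<theta> x - c)" for x
      by (simp only: Rep_f2_map[OF \<theta>, symmetric] h)
    then show ?thesis by blast
  qed
  ultimately show thesis using that \<theta> by blast
qed

text \<open>Well-definedness: the images under \<open>the_elem\<close> are singletons, so both
  quantities may be read off at one representative.\<close>

lemma out_matrix_and_act:
  assumes "g \<in> carrier (Out F2)"
  obtains \<theta> where "\<theta> \<in> auto F2" "out_matrix g = aut_matrix \<theta>"
    "\<And>p v. out_act p g v = f2_act p (f2_map \<theta>) v"
proof -
  obtain \<theta> where \<theta>: "\<theta> \<in> auto F2" and ne: "g \<noteq> {}"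
    and conj: "\<And>\<phi>. \<phi> \<in> g \<Longrightarrow> \<exists>c. \<forall>x. \<phi> (Rep_f2 x) = Rep_f2 (c + f2_map \<theta> x - c)"
    using Out_cosetE[OF assms] by blast
  have "aut_matrix \<phi> = aut_matrix \<theta>" if \<phi>: "\<phi> \<in> g" for \<phi>
  proof -
    obtain c where c: "\<And>x. \<phi> (Rep_f2 x) = Rep_f2 (c + f2_map \<theta> x - c)"
      using conj[OF \<phi>] by blast
    show ?thesis
      by (simp add: aut_matrix_def gen_eq_Rep_f2 c exp_sum_f2_conj Rep_f2_map[OF \<theta>])
  qed
  then have "out_matrix g = aut_matrix \<theta>"
    unfolding out_matrix_def by (intro the_elem_image_unique ne)
  moreover have "aut_act p \<phi> v = aut_act p \<theta> v" if \<phi>: "\<phi> \<in> g" for p \<phi> v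
  proof -
    obtain c where c: "\<And>x. \<phi> (Rep_f2 x) = Rep_f2 (c + f2_map \<theta> x - c)"
      using conj[OF \<phi>] by blast
    have "c + f2_map \<theta> X2 - c + (c + f2_map \<theta> Y2 - c) = c + f2_map \<theta> (X2 + Y2) - c"
      by (simp add: additive_map_add[OF additive_f2_map[OF \<theta>]] group_add_normalize del: add_uminus_conv_diff)
    then show ?thesis
      by (simp only: aut_act_eq_f2_act[OF \<theta>])
        (simp only: aut_act_def f2_act_def gen_eq_Rep_f2 c mult_F2 trace_poly_conj)
  qed
  then have "out_act p g v = aut_act p \<theta> v" for p v
    unfolding out_act_def by (intro the_elem_image_unique ne)
  ultimately show thesis
    using that \<theta> by (simp add: aut_act_eq_f2_act[OF \<theta>])
qed

section \<open>Eigenvalues and powers of the matrix on the abelianization\<close>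

lemma eigenvalue_charpoly:
  fixes M :: "real^2^2"
  assumes "eigenvalue M c"
  shows "c\<^sup>2 - (M $ 1 $ 1 + M $ 2 $ 2) * c + (M $ 1 $ 1 * M $ 2 $ 2 - M $ 1 $ 2 * M $ 2 $ 1) = 0"
proof -
  obtain v where v: "v \<noteq> 0" "M *v v = c *s v"
    using assms by (auto simp: eigenvalue_def)
  have 1: "M $ 1 $ 1 * v $ 1 + M $ 1 $ 2 * v $ 2 = c * v $ 1"
    and 2: "M $ 2 $ 1 * v $ 1 + M $ 2 $ 2 * v $ 2 = c * v $ 2"
    using v(2) by (simp_all add: vec_eq_iff forall_2 matrix_vector_mult_def sum_2)
  let ?e = "c\<^sup>2 - (M $ 1 $ 1 + M $ 2 $ 2) * c + (M $ 1 $ 1 * M $ 2 $ 2 - M $ 1 $ 2 * M $ 2 $ 1)"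
  \<comment> \<open>This is the adjugate of \<open>M - c\<close> applied to
    \<open>(M - c) v = 0\<close>, one coordinate at a time.\<close>
  have "?e * v $ 1 = 0" "?e * v $ 2 = 0"
    using 1 2 by algebra+
  moreover have "v $ 1 \<noteq> 0 \<or> v $ 2 \<noteq> 0"
    using v(1) by (auto simp: vec_eq_iff forall_2)
  ultimately show ?thesis by auto
qed

text \<open>First column of \<open>(l - m) M^n = l^n (M - m) - m^n (M - l)\<close>, a form of
  Cayley-Hamilton. The Y entry is the one wanted; the X entry is carried along for the
  induction.\<close>

lemma exp_sum_funpow:
  fixes l m :: real and T :: "f2 \<Rightarrow> f2"
  defines "M \<equiv> \<lambda>s g. real_of_int (exp_sum s (Rep_f2 (T g)))"
  assumes T: "additive_map T" and sum: "l + m = M GX X2 + M GY Y2"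
    and prod: "l * m = M GX X2 * M GY Y2 - M GX Y2 * M GY X2"
  shows "(l - m) * exp_sum GY (Rep_f2 ((T ^^ n) X2)) = M GY X2 * (l ^ n - m ^ n) \<and>
    (l - m) * exp_sum GX (Rep_f2 ((T ^^ n) X2)) = l ^ n * (M GX X2 - m) - m ^ n * (M GX X2 - l)"
proof (induction n)
  case 0
  show ?case by (simp add: exp_sum_f2_letter)
next
  case (Suc n)
  have rec: "real_of_int (exp_sum s (Rep_f2 ((T ^^ Suc n) X2))) =
      exp_sum GX (Rep_f2 ((T ^^ n) X2)) * M s X2 + exp_sum GY (Rep_f2 ((T ^^ n) X2)) * M s Y2" for s
    by (simp add: exp_sum_additive_map[OF T, of s "(T ^^ n) X2"] M_def)
  have key: "(l - m) * (x * c + e * d) = c * (l * P - m * Q)"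
    "(l - m) * (x * a + e * b) = l * P * (a - m) - m * Q * (a - l)"
    if "(l - m) * e = c * (P - Q)" "(l - m) * x = P * (a - m) - Q * (a - l)"
      "l + m = a + d" "l * m = a * d - b * c" for a b c d e x P Q :: real
    using that by algebra+
  show ?case
    unfolding rec power_Suc
    by (intro conjI key[OF Suc[THEN conjunct1] Suc[THEN conjunct2] sum prod])
qed

text \<open>The matrices of \<open>T\<close> and of its inverse multiply to the identity, and the
  only integer units are 1 and -1.\<close>

lemma det_f2_map:
  assumes "additive_map T" "bij T"
  defines "M \<equiv> \<lambda>s g. exp_sum s (Rep_f2 (T g))"
  shows "\<bar>M GX X2 * M GY Y2 - M GX Y2 * M GY X2\<bar> = 1"
proof -
  let ?S = "inv_into UNIV T"
  let ?N = "\<lambda>s g. exp_sum s (Rep_f2 (?S g))"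
  have ST: "?S (T x) = x" for x
    using assms(2) by (simp add: bij_is_inj)
  have "exp_sum s (Rep_f2 x) = M GX x * ?N s X2 + M GY x * ?N s Y2" for s x
    using exp_sum_additive_map[OF additive_map_inv[OF assms(1,2)], of s "T x"]
    by (simp add: ST M_def)
  from this[of GX X2] this[of GX Y2] this[of GY X2] this[of GY Y2]
  have "(M GX X2 * M GY Y2 - M GX Y2 * M GY X2) * (?N GX X2 * ?N GY Y2 - ?N GX Y2 * ?N GY X2) = 1"
    unfolding exp_sum_f2_letter by algebra
  then show ?thesis
    by (metis zmult_eq_1_iff abs_minus_cancel abs_one)
qed

lemma sum_power_le:
  fixes L :: real
  assumes "L > 1"
  shows "(\<Sum>n=1..K. L ^ n) \<le> L / (L - 1) * L ^ K"
proof (induction K)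
  case 0
  show ?case using assms by simp
next
  case (Suc K)
  have "(\<Sum>n=1..Suc K. L ^ n) \<le> L / (L - 1) * L ^ K + L ^ Suc K"
    using Suc by simp
  also have "\<dots> = L / (L - 1) * L ^ Suc K"
    using assms by (simp add: field_simps)
  finally show ?case .
qed

section \<open>Counting periodic points on the curve\<close>

text \<open>The choice is a = 2: then a - 1/a = 3/2 is a unit modulo every prime p >= 5, so
  \<open>q\<close> exists for each \<kappa> with a threshold on p that does not depend on
  \<kappa>.\<close>

lemma curve_parameters:
  assumes p: "prime p" "p \<ge> 5"
  obtains a a' q :: int and T where "[a * a' = 1] (mod int p)"
    "[(a - a')\<^sup>2 * q = 2 - \<kappa>] (mod int p)"
    "\<And>t. t \<in> {1..<int p} \<Longrightarrow> [t * T t = 1] (mod int p)"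
proof -
  have inverse: "\<exists>u. [t * u = 1] (mod int p)" if "\<not> int p dvd t" for t
  proof -
    have "coprime (int p) t" using p that by (intro prime_imp_coprime) simp_all
    then show ?thesis by (intro cong_solve_coprime_int) (simp add: coprime_commute)
  qed
  have small: "\<not> int p dvd t" if "t \<in> {1..<int p}" for t
    using that zdvd_not_zless[of t "int p"] by auto
  obtain h where h: "[2 * h = 1] (mod int p)"
    using inverse[of 2] small[of 2] p by auto
  have "\<not> int p dvd 2 - h"
  proof
    assume "int p dvd 2 - h"
    then have "int p dvd 2 * (2 - h) + (2 * h - 1)"
      using h by (intro dvd_add dvd_mult) (simp_all add: cong_iff_dvd_diff)
    then show False using small[of 3] p by simp
  qed
  then have "\<not> int p dvd (2 - h)\<^sup>2"
    using p by (simp add: prime_dvd_power_iff)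
  then obtain r where r: "[(2 - h)\<^sup>2 * r = 1] (mod int p)"
    using inverse by blast
  obtain T where T: "\<And>t. t \<in> {1..<int p} \<Longrightarrow> [t * T t = 1] (mod int p)"
    using inverse small by metis
  have "[(2 - h)\<^sup>2 * (r * (2 - \<kappa>)) = 2 - \<kappa>] (mod int p)"
    using cong_scalar_right[OF r, of "2 - \<kappa>"] by (simp add: mult.assoc)
  with h T show thesis using that by blast
qed

text \<open>A point fixed by the n-th iterate has its first coordinate fixed: the trace of the image
  of X is again \<open>a + a'\<close>. This one equation is what gets counted.\<close>

lemma card_periodic_on_curve_le:
  fixes q :: int
  assumes T: "additive_map T" "bij T" and p: "prime p"
    and a: "[a * a' = 1] (mod int p)"
    and I: "\<And>t. t \<in> {1..<int p} \<Longrightarrow> [t * I t = 1] (mod int p)"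
    and e: "exp_sum GY (Rep_f2 ((T ^^ n) X2)) \<noteq> 0"
  defines "v \<equiv> \<lambda>t. ((a + a') mod int p, (t + (1 + q) * I t) mod int p, (a * t + a' * ((1 + q) * I t)) mod int p)"
  shows "int (card {t \<in> {1..<int p}. (f2_act p T ^^ n) (v t) = v t}) \<le>
    2 * \<bar>exp_sum GY (Rep_f2 ((T ^^ n) X2))\<bar>"
proof -
  let ?g = "(T ^^ n) X2"
  have "generates ?g ((T ^^ n) Y2)"
    by (rule generates_image[OF additive_map_funpow[OF T(1)] surj_fn[OF bij_is_surj[OF T(2)]] generates_f2])
  then obtain w where w: "(GY, True) \<notin> set w" "trace_poly (Rep_f2 ?g) = trace_poly w"
    "\<bar>exp_sum GY (Rep_f2 ?g)\<bar> = int (count_Y w)"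
    by (rule basis_trace_word)
  have p0: "p > 0" using p prime_gt_0_nat by blast
  have vt: "v t \<in> residue_triples p" for t
    using p0 by (simp add: v_def residue_triples_def)
  have "[eval3 (trace_poly w) (a + a') (t + (1 + q) * I t) (a * t + a' * ((1 + q) * I t)) = a + a'] (mod int p)"
    if "(f2_act p T ^^ n) (v t) = v t" for t
  proof -
    have "f2_act p (T ^^ n) (v t) = v t"
      using that f2_act_funpow[OF T(1) vt] by simp
    then have "eval3 (trace_poly w) ((a + a') mod int p) ((t + (1 + q) * I t) mod int p)
        ((a * t + a' * ((1 + q) * I t)) mod int p) mod int p = (a + a') mod int p"
      by (simp add: f2_act_def v_def w(2))
    moreover have "[eval3 (trace_poly w) ((a + a') mod int p) ((t + (1 + q) * I t) mod int p)
        ((a * t + a' * ((1 + q) * I t)) mod int p) =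
        eval3 (trace_poly w) (a + a') (t + (1 + q) * I t) (a * t + a' * ((1 + q) * I t))] (mod int p)"
      by (intro eval3_cong_mod) (simp_all add: cong_def)
    ultimately show ?thesis by (simp add: cong_def)
  qed
  then have "{t \<in> {1..<int p}. (f2_act p T ^^ n) (v t) = v t} \<subseteq>
      {t \<in> {1..<int p}. [eval3 (trace_poly w) (a + a') (t + (1 + q) * I t)
        (a * t + a' * ((1 + q) * I t)) = a + a'] (mod int p)}" by blast
  moreover have "finite {t \<in> {1..<int p}. P t}" for P
    by (rule finite_subset[of _ "{1..<int p}"]) auto
  ultimately have "card {t \<in> {1..<int p}. (f2_act p T ^^ n) (v t) = v t} \<le>
      card {t \<in> {1..<int p}. [eval3 (trace_poly w) (a + a') (t + (1 + q) * I t)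
        (a * t + a' * ((1 + q) * I t)) = a + a'] (mod int p)}"
    by (intro card_mono)
  also have "\<dots> \<le> 2 * count_Y w"
    by (rule card_curve_fixed_le[OF w(1) _ p a cong_refl I]) (use w(3) e in auto)
  finally show ?thesis using w(3) by simp
qed

text \<open>The determinant is 1 or -1, so the two eigenvalues have moduli with product 1, and the
  larger modulus exceeds 1.\<close>

lemma pseudo_Anosov_eigenvalues:
  fixes l :: real
  assumes g: "out_matrix g = aut_matrix \<theta>" "\<theta> \<in> auto F2" and "pseudo_Anosov g" "largest_eigenvalue g l"
  obtains m where "\<bar>m\<bar> < \<bar>l\<bar>" "\<bar>l\<bar> > 1" "exp_sum GY (Rep_f2 (f2_map \<theta> X2)) \<noteq> 0"
    "\<And>n. (l - m) * exp_sum GY (Rep_f2 ((f2_map \<theta> ^^ n) X2)) =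
       exp_sum GY (Rep_f2 (f2_map \<theta> X2)) * (l ^ n - m ^ n)"
proof -
  let ?T = "f2_map \<theta>"
  define M where "M = (\<lambda>s g. exp_sum s (Rep_f2 (?T g)))"
  note T = additive_f2_map[OF g(2)] bij_f2_map[OF g(2)]
  obtain m where m: "out_eigenvalue g m" "m \<noteq> l"
    using assms(3) unfolding pseudo_Anosov_def by blast
  have l: "out_eigenvalue g l" and ml: "\<bar>m\<bar> < \<bar>l\<bar>"
    using assms(4) m by (auto simp: largest_eigenvalue_def)
  let ?D = "M GX X2 * M GY Y2 - M GX Y2 * M GY X2"
  have char: "c\<^sup>2 - (real_of_int (M GX X2) + M GY Y2) * c + ?D = 0" if "out_eigenvalue g c" for c
    using eigenvalue_charpoly[OF that[unfolded out_eigenvalue_def]] Rep_f2_map[OF g(2)]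
    by (simp add: map_matrix_def g(1) aut_matrix_def gen_eq_Rep_f2 M_def)
  \<comment> \<open>The difference of the two characteristic equations; cancelling
    \<open>l - m\<close> identifies the trace.\<close>
  have "(l - m) * (l + m - (M GX X2 + M GY Y2)) = 0"
    using char[OF l] char[OF m(1)] by (simp add: algebra_simps power2_eq_square)
  then have sum: "l + m = real_of_int (M GX X2) + M GY Y2"
    using m(2) by simp
  then have "l * m = ?D"
    using char[OF l] by (simp add: algebra_simps power2_eq_square flip: sum)
  then have prod: "l * m = real_of_int (M GX X2) * M GY Y2 - real_of_int (M GX Y2) * M GY X2"
    by simp
  have D: "\<bar>?D\<bar> = 1"
    using det_f2_map[OF T] by (simp add: M_def)
  then have lm: "\<bar>l\<bar> * \<bar>m\<bar> = 1"
    using \<open>l * m = ?D\<close> by (metis abs_mult of_int_1 of_int_abs)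
  have "\<bar>l\<bar> > 1"
  proof (rule ccontr)
    assume "\<not> \<bar>l\<bar> > 1"
    then have "\<bar>l\<bar> * \<bar>m\<bar> \<le> \<bar>m\<bar>" by (intro mult_left_le_one_le) auto
    with lm ml \<open>\<not> \<bar>l\<bar> > 1\<close> show False by simp
  qed
  moreover have "M GY X2 \<noteq> 0"
  proof
    \<comment> \<open>A triangular integer matrix of determinant 1 or -1 has diagonal entries 1 or
      -1, which would force \<open>\<bar>l\<bar> = 1\<close>.\<close>
    assume 0: "M GY X2 = 0"
    then have "\<bar>M GX X2\<bar> = 1"
      using D by (auto simp: abs_mult zmult_eq_1_iff dest: abs_zmult_eq_1)
    moreover have "\<bar>M GY Y2\<bar> = 1"
      using D 0 abs_zmult_eq_1[of "M GY Y2" "M GX X2"] by (simp add: mult.commute)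
    moreover have "(l - M GX X2) * (l - M GY Y2) = 0"
      using char[OF l] 0 by (simp add: algebra_simps power2_eq_square)
    ultimately have "\<bar>l\<bar> = 1" by auto
    with \<open>\<bar>l\<bar> > 1\<close> show False by simp
  qed
  moreover have "(l - m) * exp_sum GY (Rep_f2 ((?T ^^ n) X2)) = M GY X2 * (l ^ n - m ^ n)" for n
    using exp_sum_funpow[OF T(1), of l m n] sum prod by (simp add: M_def)
  ultimately show thesis
    using that ml by (simp add: M_def)
qed

lemma card_le_sum_of_cover:
  assumes "finite N" "A \<subseteq> (\<Union>n\<in>N. B n)" "\<And>n. n \<in> N \<Longrightarrow> finite (B n)"
    "\<And>n. n \<in> N \<Longrightarrow> real (card (B n)) \<le> f n"
  shows "real (card A) \<le> (\<Sum>n\<in>N. f n)"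
proof -
  have "card A \<le> card (\<Union>n\<in>N. B n)"
    using assms by (intro card_mono) auto
  also have "\<dots> \<le> (\<Sum>n\<in>N. card (B n))"
    by (rule card_UN_le[OF assms(1)])
  finally have "real (card A) \<le> (\<Sum>n\<in>N. real (card (B n)))"
    by (metis of_nat_le_iff of_nat_sum)
  also have "\<dots> \<le> (\<Sum>n\<in>N. f n)"
    using assms(4) by (rule sum_mono)
  finally show ?thesis .
qed

theorem theorem1p5:
  fixes g :: "(letter list \<Rightarrow> letter list) set" and lam :: real
  assumes "g \<in> carrier (Out F2)"
    and "pseudo_Anosov g"
    and "largest_eigenvalue g lam"
  shows "\<exists>C::real. \<forall>\<kappa>::int. \<exists>p0::nat. \<forall>p\<ge>p0. prime p \<longrightarrow>
           (\<exists>v\<in>XF \<kappa> p. real (card (orbit (out_act p g) v)) \<ge> ln (real p) / ln \<bar>lam\<bar> - C)"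
proof -
  obtain \<theta> where \<theta>: "\<theta> \<in> auto F2" "out_matrix g = aut_matrix \<theta>"
    and act: "\<And>p v. out_act p g v = f2_act p (f2_map \<theta>) v"
    using out_matrix_and_act[OF assms(1)] by blast
  define T where "T = f2_map \<theta>"
  define e where "e n = exp_sum GY (Rep_f2 ((T ^^ n) X2))" for n
  define \<gamma> where "\<gamma> = exp_sum GY (Rep_f2 (T X2))"
  define L where "L = \<bar>lam\<bar>"
  obtain m where m: "\<bar>m\<bar> < L" and L: "L > 1" and \<gamma>: "\<gamma> \<noteq> 0"
    and e: "\<And>n. (lam - m) * e n = \<gamma> * (lam ^ n - m ^ n)"
    using pseudo_Anosov_eigenvalues[OF \<theta>(2,1) assms(2,3)]
    unfolding T_def e_def \<gamma>_def L_def by blast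
  note T = additive_f2_map[OF \<theta>(1), folded T_def] bij_f2_map[OF \<theta>(1), folded T_def]
  have lm: "\<bar>lam - m\<bar> > 0" using m by (auto simp: L_def)
  \<comment> \<open>One factor 2 is the root bound 2 N; the other comes from
    \<open>\<bar>lam ^ n - m ^ n\<bar> \<le> 2 * L ^ n\<close>.\<close>
  define c where "c = 4 * \<bar>\<gamma>\<bar> / \<bar>lam - m\<bar>"
  have c: "c > 0" using \<gamma> lm by (simp add: c_def)
  have pow: "\<bar>m\<bar> ^ n \<le> L ^ n" for n
    using m by (intro power_mono) auto
  have e_le: "2 * \<bar>e n\<bar> \<le> c * L ^ n" for n
  proof -
    have "\<bar>lam - m\<bar> * \<bar>real_of_int (e n)\<bar> = \<bar>\<gamma>\<bar> * \<bar>lam ^ n - m ^ n\<bar>"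
      using e[of n] by (metis abs_mult of_int_abs)
    also have "\<dots> \<le> \<bar>\<gamma>\<bar> * (2 * L ^ n)"
      using pow[of n] abs_triangle_ineq4[of "lam ^ n" "m ^ n"]
      by (intro mult_left_mono) (auto simp: L_def power_abs)
    finally show ?thesis
      using lm by (simp add: c_def field_simps)
  qed
  have e_nz: "e n \<noteq> 0" if "n > 0" for n
  proof
    assume "e n = 0"
    then have "lam ^ n = m ^ n" using e[of n] \<gamma> by simp
    then have "L ^ n = \<bar>m\<bar> ^ n" by (metis L_def power_abs)
    moreover have "\<bar>m\<bar> ^ n < L ^ n" using m that by (intro power_strict_mono) auto
    ultimately show False by simp
  qed
  \<comment> \<open>\<open>c * (L / (L - 1))\<close> bounds the geometric sum, and the factor 4
    leaves p / 4 against p - 1 at the end. Only \<open>g\<close> enters, so C =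
    \<open>ln b / ln L\<close> is independent of \<kappa>.\<close>
  define b where "b = 4 * c * (L / (L - 1))"
  have b: "b > 0" using c L by (simp add: b_def)
  have "\<exists>v\<in>XF \<kappa> p. real (card (orbit (out_act p g) v)) \<ge> ln (real p) / ln L - ln b / ln L"
    if p: "prime p" "p \<ge> 5" for \<kappa> p
  proof (rule ccontr)
    define bound where "bound = ln (real p) / ln L - ln b / ln L"
    assume "\<not> ?thesis"
    then have short: "real (card (orbit (out_act p g) v)) < bound" if "v \<in> XF \<kappa> p" for v
      using that by (auto simp: bound_def not_le)
    obtain a a' q I where a: "[a * a' = 1] (mod int p)"
      and q: "[(a - a')\<^sup>2 * q = 2 - \<kappa>] (mod int p)"
      and I: "\<And>t. t \<in> {1..<int p} \<Longrightarrow> [t * I t = 1] (mod int p)"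
      using curve_parameters[OF p] by blast
    define v where "v = (\<lambda>t. ((a + a') mod int p, (t + (1 + q) * I t) mod int p,
      (a * t + a' * ((1 + q) * I t)) mod int p))"
    have v_XF: "v t \<in> XF \<kappa> p" if t: "t \<in> {1..<int p}" for t
    proof -
      let ?x = "a + a'" and ?y = "t + (1 + q) * I t" and ?z = "a * t + a' * ((1 + q) * I t)"
      have "[?x\<^sup>2 + ?y\<^sup>2 + ?z\<^sup>2 = ?x * ?y * ?z + 2 + \<kappa>] (mod int p)"
        by (rule curve_on_surface[OF a cong_refl I[OF t] q]) (rule refl)+
      moreover have r: "[u mod int p = u] (mod int p)" for u
        by (simp add: cong_def)
      have "[(?x mod int p)\<^sup>2 + (?y mod int p)\<^sup>2 + (?z mod int p)\<^sup>2 = ?x\<^sup>2 + ?y\<^sup>2 + ?z\<^sup>2] (mod int p)"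
        by (intro cong_add cong_pow r)
      moreover have "[?x * ?y * ?z + 2 + \<kappa> =
          (?x mod int p) * (?y mod int p) * (?z mod int p) + 2 + \<kappa>] (mod int p)"
        by (intro cong_add cong_mult cong_sym[OF r] cong_refl)
      ultimately have "[(?x mod int p)\<^sup>2 + (?y mod int p)\<^sup>2 + (?z mod int p)\<^sup>2 =
          (?x mod int p) * (?y mod int p) * (?z mod int p) + 2 + \<kappa>] (mod int p)"
        by (blast intro: cong_trans)
      then show ?thesis using p by (simp add: v_def XF_def)
    qed
    let ?f = "f2_act p T"
    have f: "out_act p g = ?f" by (rule ext) (simp add: act T_def)
    define Fix where "Fix n = {t \<in> {1..<int p}. (?f ^^ n) (v t) = v t}" for n
    have fin_Fix: "finite (Fix n)" for n
      unfolding Fix_def by (rule finite_subset[of _ "{1..<int p}"]) auto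
    have returns: "\<exists>n>0. real n < bound \<and> t \<in> Fix n" if t: "t \<in> {1..<int p}" for t
    proof -
      have "finite (residue_triples p)" by (simp add: residue_triples_def)
      moreover have "?f ` residue_triples p \<subseteq> residue_triples p"
        using p f2_act_residue_triples by auto
      moreover note inj_on_f2_act[OF T]
      moreover have "v t \<in> residue_triples p"
        using p by (simp add: v_def residue_triples_def)
      ultimately obtain n where "0 < n" "n \<le> card (orbit ?f (v t))" "(?f ^^ n) (v t) = v t"
        by (rule funpow_returns_within_orbit)
      then show ?thesis
        using short[OF v_XF[OF t]] t unfolding f Fix_def by (intro exI[of _ n]) auto
    qed
    define K where "K = nat \<lfloor>bound\<rfloor>"
    \<comment> \<open>\<open>nat\<close> would send a negative floor to 0, above
      \<open>bound\<close>; the return time of the parameter 1 excludes this.\<close>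
    have "bound > 0"
      using returns[of 1] p by auto
    then have K: "real K \<le> bound"
      unfolding K_def by simp
    \<comment> \<open>The count is of parameters t, so coincidences among the points
      \<open>v t\<close> do no harm.\<close>
    have "{1..<int p} \<subseteq> (\<Union>n\<in>{1..K}. Fix n)"
    proof
      fix t assume "t \<in> {1..<int p}"
      then obtain n where "n > 0" "real n < bound" "t \<in> Fix n" using returns by blast
      then show "t \<in> (\<Union>n\<in>{1..K}. Fix n)"
        by (intro UN_I[of n]) (auto simp: K_def le_nat_floor)
    qed
    moreover have "real (card (Fix n)) \<le> c * L ^ n" if "n \<in> {1..K}" for n
    proof -
      have "int (card (Fix n)) \<le> 2 * \<bar>e n\<bar>"
        using card_periodic_on_curve_le[OF T p(1) a I, of n] e_nz[of n] that
        unfolding Fix_def v_def e_def by auto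
      then show ?thesis using e_le[of n] by linarith
    qed
    ultimately have "real (card {1..<int p}) \<le> (\<Sum>n\<in>{1..K}. c * L ^ n)"
      by (rule card_le_sum_of_cover[OF finite_atLeastAtMost _ fin_Fix])
    then have "real p - 1 \<le> c * (\<Sum>n=1..K. L ^ n)"
      using p by (simp add: sum_distrib_left of_nat_diff)
    also have "\<dots> \<le> c * (L / (L - 1) * L ^ K)"
      using c sum_power_le[OF L] by (intro mult_left_mono) auto
    also have "\<dots> = b / 4 * L ^ K"
      using L by (simp add: b_def divide_simps)
    \<comment> \<open>\<open>bound\<close> is the logarithm of p / b to the base \<open>L\<close>,
      so \<open>L ^ K\<close> is at most p / b.\<close>
    also have "\<dots> \<le> b / 4 * (real p / b)"
    proof -
      have "L ^ K = exp (real K * ln L)"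
        using L by (simp add: exp_of_nat_mult)
      also have "\<dots> \<le> exp (bound * ln L)"
        using K L by (simp add: mult_right_mono)
      also have "bound * ln L = ln (real p / b)"
        using L b p by (simp add: bound_def ln_div field_simps)
      also have "exp \<dots> = real p / b" using b p by simp
      finally show ?thesis using b by (intro mult_left_mono) auto
    qed
    finally show False using b p by simp
  qed
  then show ?thesis unfolding L_def by blast
qed

end
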